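(* Let $L,T>0$, $\Omega=(0,L)$, $1/2<\alpha\le1$, and let $t_n=nk$ for $0\le n\le N$ with uniform time step $k=T/N$. Let $U^0\in H^1_0(\Omega)\cap H^2(\Omega)$, let $\bar g^1,\dots,\bar g^N\in L_2(\Omega)$, write $F^n(x)=F(x,t_n)$, and assume that $$1+F(x,t_n)^2+F_x(x,t_n)^2\le C_F\quad\text{for }0<x<L\text{ and }1\le n\le N,$$ where $C_F$ is a constant. Let $U^1,\dots,U^N$ be determined by the implicit scheme $$U^n-U^{n-1}-\int_{t_{n-1}}^{t_n}\partial_t^{1-\alpha}\check U_{xx}\,dt+\int_{t_{n-1}}^{t_n}\bigl(F^n\partial_t^{1-\alpha}\check U\bigr)_x\,dt=k\bar g^n,\qquad U^n(0)=0=U^n(L),\qquad 1\le n\le N.$$ If $k$ is sufficiently small, then for $1\le n\le N$, $$\|U^n-U^0\|^2\le t_n\,E_\alpha\biggl(\frac{C_1t_n^{2\alpha}}{\Gamma(\alpha+1)}\biggr)\biggl[C_2\sum_{j=1}^nk\|\bar g^j\|^2+C_3\|U^0\|_2^2\biggl(1+\frac{t_n^{2\alpha-1}}{2\alpha-1}\biggr)\biggr],$$ where $C_1=24C_F(1+2C_F)$, $C_2=6(1+2C_F)$ and $C_3=6C_F(1+4C_F)$.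
   Context: $\|\cdot\|$ is the norm of $L_2(\Omega)$ and $\|\cdot\|_r$ the norm of $H^r(\Omega)$; subscript $x$ denotes $\partial/\partial x$. For a sequence $(v^n)$, $\check v$ is the piecewise-constant function with $\check v(t)=v^n$ for $t_{n-1}<t<t_n$. The fractional integral is $I^\alpha v(t)=\int_0^t\omega_\alpha(t-s)v(s)\,ds$ with $\omega_\alpha(t)=t^{\alpha-1}/\Gamma(\alpha)$, and $\partial_t^{1-\alpha}v=(I^\alpha v)_t$ (Riemann--Liouville), so that $\int_{t_{n-1}}^{t_n}\partial_t^{1-\alpha}\check v\,dt=(I^\alpha\check v)(t_n)-(I^\alpha\check v)(t_{n-1})$, with $(I^\alpha\check v)(0)=0$. The Mittag--Leffler function is $E_\beta(z)=\sum_{n=0}^\infty z^n/\Gamma(1+n\beta)$. The scheme is a time discretization of $u_t-\kappa_\alpha\partial_t^{1-\alpha}u_{xx}+\mu_\alpha^{-1}(F\partial_t^{1-\alpha}u)_x=g$ on $0<x<L$, $0<t<T$, with homogeneous Dirichlet boundary conditions and $\kappa_\alpha=\mu_\alpha=1$; here $F=F(x,t)$ and $g=g(x,t)$ are given functions and $\bar g^n\approx k^{-1}\int_{t_{n-1}}^{t_n}g(t)\,dt$. At each step it is a linear elliptic boundary-value problem for $U^n\in H^1_0(\Omega)$. *)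

theory Defs
  imports "HOL-Analysis.Analysis"
begin

section \<open>Sobolev spaces on the interval \<open>(0, L)\<close>\<close>

text \<open>Elements of \<open>L\<^sub>2\<close> and of the Sobolev spaces are represented by arbitrary representatives
  \<open>real \<Rightarrow> real\<close>; their values outside \<open>(0, L)\<close> and on null sets play no role below.\<close>

abbreviation Omega :: "real \<Rightarrow> real measure" where
  "Omega L \<equiv> lebesgue_on {0<..<L}"

definition L2 :: "real \<Rightarrow> (real \<Rightarrow> real) set" where
  "L2 L = {u \<in> borel_measurable (Omega L). integrable (Omega L) (\<lambda>x. (u x)\<^sup>2)}"

definition L2_norm :: "real \<Rightarrow> (real \<Rightarrow> real) \<Rightarrow> real" where
  "L2_norm L u = sqrt (\<integral>x. (u x)\<^sup>2 \<partial>Omega L)"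

definition test_functions :: "real \<Rightarrow> (real \<Rightarrow> real) set" where
  "test_functions L = {\<phi>. (\<forall>m. (deriv ^^ m) \<phi> differentiable_on UNIV) \<and>
     (\<exists>a b. 0 < a \<and> b < L \<and> (\<forall>x. x \<notin> {a..b} \<longrightarrow> \<phi> x = 0))}"

text \<open>Distributions are used only through their values on test functions.\<close>

definition regular_distr :: "real \<Rightarrow> (real \<Rightarrow> real) \<Rightarrow> (real \<Rightarrow> real) \<Rightarrow> real" where
  "regular_distr L u \<phi> = (\<integral>x. u x * \<phi> x \<partial>Omega L)"

definition distr_deriv :: "((real \<Rightarrow> real) \<Rightarrow> real) \<Rightarrow> (real \<Rightarrow> real) \<Rightarrow> real" where
  "distr_deriv D \<phi> = - D (deriv \<phi>)"

definition has_weak_deriv :: "real \<Rightarrow> (real \<Rightarrow> real) \<Rightarrow> (real \<Rightarrow> real) \<Rightarrow> bool" where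
  "has_weak_deriv L u v \<longleftrightarrow>
     (\<forall>\<phi>\<in>test_functions L. distr_deriv (regular_distr L u) \<phi> = regular_distr L v \<phi>)"

text \<open>A representative of the weak derivative, which is unique almost everywhere.  It is only
  meaningful when some weak derivative in \<open>L\<^sub>2\<close> exists, as membership in \<open>sobolev\<close> demands.\<close>

definition weak_deriv :: "real \<Rightarrow> (real \<Rightarrow> real) \<Rightarrow> real \<Rightarrow> real" where
  "weak_deriv L u = (SOME v. v \<in> L2 L \<and> has_weak_deriv L u v)"

definition sobolev :: "real \<Rightarrow> nat \<Rightarrow> (real \<Rightarrow> real) set" where
  "sobolev L r = {u. (\<forall>i\<le>r. (weak_deriv L ^^ i) u \<in> L2 L) \<and>
     (\<forall>i<r. has_weak_deriv L ((weak_deriv L ^^ i) u) ((weak_deriv L ^^ Suc i) u))}"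

definition sobolev_norm :: "real \<Rightarrow> nat \<Rightarrow> (real \<Rightarrow> real) \<Rightarrow> real" where
  "sobolev_norm L r u = sqrt (\<Sum>i\<le>r. (L2_norm L ((weak_deriv L ^^ i) u))\<^sup>2)"

text \<open>The closure of the test functions in the norm of \<open>H\<^sup>1\<close>, i.e. \<open>\<phi>\<^sub>m\<close> and \<open>\<phi>\<^sub>m'\<close> converge
  in \<open>L\<^sub>2\<close> to \<open>u\<close> and to its weak derivative.  Membership encodes the homogeneous Dirichlet
  conditions \<open>u(0) = 0 = u(L)\<close>.\<close>

definition H10 :: "real \<Rightarrow> (real \<Rightarrow> real) set" where
  "H10 L = {u \<in> sobolev L 1. \<exists>\<phi>. (\<forall>m. \<phi> m \<in> test_functions L) \<and>
     (\<lambda>m::nat. L2_norm L (\<lambda>x. u x - \<phi> m x)) \<longlonglongrightarrow> 0 \<and>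
     (\<lambda>m. L2_norm L (\<lambda>x. weak_deriv L u x - deriv (\<phi> m) x)) \<longlonglongrightarrow> 0}"

section \<open>Fractional calculus in time\<close>

definition omega :: "real \<Rightarrow> real \<Rightarrow> real" where
  "omega \<alpha> t = t powr (\<alpha> - 1) / Gamma \<alpha>"

definition frac_integral :: "real \<Rightarrow> (real \<Rightarrow> real) \<Rightarrow> real \<Rightarrow> real" where
  "frac_integral \<alpha> v t = (LINT s:{0..t}|lborel. omega \<alpha> (t - s) * v s)"

text \<open>The Riemann--Liouville derivative of order \<open>1 - \<alpha>\<close>.\<close>

definition frac_deriv :: "real \<Rightarrow> (real \<Rightarrow> real) \<Rightarrow> real \<Rightarrow> real" where
  "frac_deriv \<alpha> v t = deriv (frac_integral \<alpha> v) t"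

definition mittag_leffler :: "real \<Rightarrow> real \<Rightarrow> real" where
  "mittag_leffler \<beta> z = (\<Sum>n. z ^ n / Gamma (1 + real n * \<beta>))"

section \<open>The implicit scheme\<close>

text \<open>The value is \<open>v n\<close> for \<open>(n - 1) k < t \<le> n k\<close>, \<open>n \<ge> 1\<close>.\<close>

definition pw_const :: "real \<Rightarrow> (nat \<Rightarrow> real) \<Rightarrow> real \<Rightarrow> real" where
  "pw_const k v t = v (nat \<lceil>t / k\<rceil>)"

text \<open>The \<open>n\<close>-th step, with \<open>t\<^sub>n = n k\<close>, as an equality of distributions on \<open>(0, L)\<close>: \<open>U n\<close> is
  only known to be in \<open>H\<^sup>1\<^sub>0\<close>, so that \<open>U\<^sub>x\<^sub>x\<close> and \<open>(F \<partial>\<^sub>tU)\<^sub>x\<close> (with the fractional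
  derivative of order \<open>1 - \<alpha>\<close>) are distributional derivatives.\<close>

definition scheme_step ::
    "real \<Rightarrow> real \<Rightarrow> real \<Rightarrow> (real \<Rightarrow> real \<Rightarrow> real) \<Rightarrow> (nat \<Rightarrow> real \<Rightarrow> real) \<Rightarrow>
     (nat \<Rightarrow> real \<Rightarrow> real) \<Rightarrow> nat \<Rightarrow> bool" where
  "scheme_step L \<alpha> k F g U n \<longleftrightarrow>
     (\<forall>\<phi>\<in>test_functions L.
        regular_distr L (\<lambda>x. U n x - U (n - 1) x) \<phi>
        - (LINT t:{real (n - 1) * k..real n * k}|lborel.
             frac_deriv \<alpha> (pw_const k (\<lambda>j. distr_deriv (distr_deriv (regular_distr L (U j))) \<phi>)) t)
        + (LINT t:{real (n - 1) * k..real n * k}|lborel.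
             distr_deriv (regular_distr L
               (\<lambda>x. F x (real n * k) * frac_deriv \<alpha> (pw_const k (\<lambda>j. U j x)) t)) \<phi>)
        = k * regular_distr L (g n) \<phi>)"

end

(* Write w^n = (U^n - U^(n-1)) / k and J^n for the convolution of the quadrature weights with w, a
   discrete fractional integral.  Divided by k, the scheme reads w - J_xx + (F J)_x = f, where f
   collects g and the contribution of U^0, which lies in H^2.  It is tested with w + 2 C J.  The weights
   are decreasing and convex, so their convolution is positive and the terms <J_x, w_x> and <J, w> can
   be dropped after summation in n; what remains bounds the sum of |w|^2 by the sums of |J|^2 and |f|^2.
   By Cauchy-Schwarz, |J^n|^2 is at most t_n^alpha / Gamma(alpha + 1) times the convolution of the weights
   with |w|^2.  For small k the implicit last term is absorbed, and a discrete fractional Gronwall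
   inequality, obtained by comparing sums with Beta integrals, produces the Mittag-Leffler function. *)
theory Submission
  imports Defs
begin

section \<open>Convolution quadrature weights\<close>

text \<open>The unknown is w and not U because, once the time integrals are summed by parts, the
  fractional integral acts on increments, and U^n - U^0 is k times a sum of w. The price is a
  leftover b_(n-1) U^0, which enters f with the factor b_(n-1) / k, of order t_n^(\<alpha>-1). Its
  square has a time sum bounded uniformly in k only for \<alpha> > 1/2; this is the origin of
  t_n^(2\<alpha>-1) / (2\<alpha>-1). Testing with w alone would leave the |J_x|^2 coming from the
  drift without control, as <J_x, w_x> has a sign only after summation and bounds nothing. The part
  2 C J of the test function supplies 2 C |J_x|^2, which is enough. The obstacle is regularity. The
  scheme holds against smooth functions only, F^n need not have a continuous derivative, and the
  time derivative of a step function can be singular at the nodes. So the latter is computed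
  explicitly off a null set, the equation is extended by density to U^j, and the energy argument is
  an inequality between real numbers at fixed x that is integrated at the end.\<close>

lemma sum_symmetric_square:
  fixes s :: "nat \<Rightarrow> nat \<Rightarrow> real"
  assumes "\<And>i j. s i j = s j i"
  shows "(\<Sum>i=1..N. \<Sum>j=1..N. s i j) = 2 * (\<Sum>i=1..N. \<Sum>j=1..i. s i j) - (\<Sum>i=1..N. s i i)"
proof (induction N)
  case (Suc N)
  have "(\<Sum>i=1..N. s i (Suc N)) = (\<Sum>j=1..N. s (Suc N) j)"
    using assms by (intro sum.cong) auto
  then show ?case using Suc by (simp add: sum.distrib)
qed simp

text \<open>The truncated difference p - (i - j) counts the integers common to the windows (i, i+p]
  and (j, j+p]. The symmetric kernel is thus a Gram matrix and its form a sum of squares over q. The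
  sum over j <= n is half the full sum plus half the diagonal.\<close>

lemma window_kernel_nonneg:
  fixes a :: "nat \<Rightarrow> real"
  shows "0 \<le> (\<Sum>n=1..N. \<Sum>j=1..n. real (p - (n - j)) * a j * a n)"
proof -
  define w where "w i q = (of_bool (i < q \<and> q \<le> i + p) :: real)" for i q :: nat
  define s where "s i j = (\<Sum>q\<le>N+p. w i q * w j q) * a i * a j" for i j
  have overlap: "(\<Sum>q\<le>N+p. w i q * w j q) = real (p - (i - j))"
    if "i \<le> N" "j \<le> i" for i j
  proof -
    have "(\<Sum>q\<le>N+p. w i q * w j q) = (\<Sum>q\<le>N+p. of_bool (q \<in> {i<..j+p}))"
      using that by (intro sum.cong) (auto simp: w_def)
    also have "\<dots> = real (card ({..N+p} \<inter> {i<..j+p}))"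
      by (subst sum_of_bool_eq) (auto intro!: arg_cong[of _ _ card])
    also have "{..N+p} \<inter> {i<..j+p} = {i<..j+p}"
      using that by auto
    also have "real (card {i<..j+p}) = real (p - (i - j))"
      using that by simp
    finally show ?thesis .
  qed
  have "(\<Sum>i=1..N. \<Sum>j=1..N. s i j) = (\<Sum>q\<le>N+p. (\<Sum>i=1..N. w i q * a i)\<^sup>2)"
  proof -
    have "(\<Sum>i=1..N. \<Sum>j=1..N. s i j)
        = (\<Sum>i=1..N. \<Sum>j=1..N. \<Sum>q\<le>N+p. (w i q * a i) * (w j q * a j))"
      unfolding s_def sum_distrib_right by (simp add: mult_ac)
    also have "\<dots> = (\<Sum>i=1..N. \<Sum>q\<le>N+p. \<Sum>j=1..N. (w i q * a i) * (w j q * a j))"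
      by (intro sum.cong refl sum.swap)
    also have "\<dots> = (\<Sum>q\<le>N+p. \<Sum>i=1..N. \<Sum>j=1..N. (w i q * a i) * (w j q * a j))"
      by (rule sum.swap)
    also have "\<dots> = (\<Sum>q\<le>N+p. (\<Sum>i=1..N. w i q * a i)\<^sup>2)"
      by (simp add: power2_eq_square sum_product)
    finally show ?thesis .
  qed
  then have "0 \<le> (\<Sum>i=1..N. \<Sum>j=1..N. s i j)"
    by (simp add: sum_nonneg)
  also have "\<dots> = 2 * (\<Sum>i=1..N. \<Sum>j=1..i. s i j) - (\<Sum>i=1..N. s i i)"
    by (rule sum_symmetric_square) (simp add: s_def mult_ac)
  also have "(\<Sum>i=1..N. s i i) = (\<Sum>i=1..N. real p * (a i)\<^sup>2)"
    by (intro sum.cong) (auto simp: s_def overlap power2_eq_square)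
  also have "(\<Sum>i=1..N. \<Sum>j=1..i. s i j) = (\<Sum>n=1..N. \<Sum>j=1..n. real (p - (n - j)) * a j * a n)"
    by (intro sum.cong) (auto simp: s_def overlap)
  finally show ?thesis
    using sum_nonneg[of "{1..N}" "\<lambda>i. real p * (a i)\<^sup>2"] by simp
qed

text \<open>A convex sequence is, on an initial segment, a nonnegative combination of the constant
  sequence and the truncated linear sequences \<open>m \<mapsto> max 0 (q - m)\<close>.\<close>

lemma convex_sequence_decomposition:
  fixes c :: "nat \<Rightarrow> real"
  assumes "m \<le> N"
  shows "c m = c N + real (N - m) * (c N - c (Suc N))
    + (\<Sum>q=1..N. real (q - m) * (c (q - 1) - 2 * c q + c (Suc q)))"
  using assms
proof (induction N)
  case (Suc N)
  show ?case
  proof (cases "m = Suc N")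
    case False
    with Suc have "m \<le> N" by simp
    then have "real (Suc N - m) = real (N - m) + 1" by simp
    with Suc.IH[OF \<open>m \<le> N\<close>] show ?thesis by (simp add: algebra_simps)
  qed simp
qed simp

text \<open>The coefficients of the decomposition are c N, the slope c N - c (Suc N) and second
  differences, all nonnegative by assumption, and each building block is a positive kernel. It will
  be applied to real sequences, the values of w or dw at a fixed x.\<close>

lemma convex_kernel_nonneg:
  fixes a c :: "nat \<Rightarrow> real"
  assumes c_nonneg: "\<And>m. 0 \<le> c m" and c_dec: "\<And>m. c (Suc m) \<le> c m"
    and c_conv: "\<And>m. 0 \<le> c m - 2 * c (Suc m) + c (Suc (Suc m))"
  shows "0 \<le> (\<Sum>n=1..N. (\<Sum>j=1..n. c (n - j) * a j) * a n)"
proof -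
  let ?d = "\<lambda>q. c (q - 1) - 2 * c q + c (Suc q)"
  let ?Q = "\<lambda>k. \<Sum>n=1..N. \<Sum>j=1..n. k (n - j) * a j * a n"
  \<comment> \<open>The constant kernel gives half of (sum of a)^2 plus half of the sum of
    squares.\<close>
  have const: "?Q (\<lambda>m. 1) \<ge> 0"
  proof -
    have "(\<Sum>i=1..N. \<Sum>j=1..N. a j * a i) = (\<Sum>i=1..N. a i)\<^sup>2"
      by (simp add: power2_eq_square sum_product mult_ac)
    then have "(\<Sum>i=1..N. a i)\<^sup>2 = 2 * (\<Sum>i=1..N. \<Sum>j=1..i. a j * a i) - (\<Sum>i=1..N. a i * a i)"
      using sum_symmetric_square[of "\<lambda>i j. a j * a i" N] by (simp add: mult_ac)
    then have "0 \<le> 2 * (\<Sum>i=1..N. \<Sum>j=1..i. a j * a i) - (\<Sum>i=1..N. a i * a i)"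
      using zero_le_power2[of "\<Sum>i=1..N. a i"] by linarith
    then show ?thesis
      using sum_nonneg[of "{1..N}" "\<lambda>i. a i * a i"] by (simp add: mult.commute)
  qed
  have "c (n - j) * a j * a n = c N * (1 * a j * a n)
      + (c N - c (Suc N)) * (real (N - (n - j)) * a j * a n)
      + (\<Sum>q=1..N. ?d q * (real (q - (n - j)) * a j * a n))" if "n \<in> {1..N}" for n j
    using that
    by (subst convex_sequence_decomposition[of "n - j" N])
      (auto simp: algebra_simps sum_distrib_left sum_distrib_right)
  then have "?Q c = (\<Sum>n=1..N. \<Sum>j=1..n. c N * (1 * a j * a n)
      + (c N - c (Suc N)) * (real (N - (n - j)) * a j * a n)
      + (\<Sum>q=1..N. ?d q * (real (q - (n - j)) * a j * a n)))"
    by (intro sum.cong) auto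
  also have "\<dots> = c N * ?Q (\<lambda>m. 1) + (c N - c (Suc N)) * ?Q (\<lambda>m. real (N - m))
      + (\<Sum>n=1..N. \<Sum>j=1..n. \<Sum>q=1..N. ?d q * (real (q - (n - j)) * a j * a n))"
    by (simp only: sum.distrib sum_distrib_left)
  also have "(\<Sum>n=1..N. \<Sum>j=1..n. \<Sum>q=1..N. ?d q * (real (q - (n - j)) * a j * a n))
      = (\<Sum>n=1..N. \<Sum>q=1..N. \<Sum>j=1..n. ?d q * (real (q - (n - j)) * a j * a n))"
    by (intro sum.cong refl sum.swap)
  also have "\<dots> = (\<Sum>q=1..N. \<Sum>n=1..N. \<Sum>j=1..n. ?d q * (real (q - (n - j)) * a j * a n))"
    by (rule sum.swap)
  also have "\<dots> = (\<Sum>q=1..N. ?d q * ?Q (\<lambda>m. real (q - m)))"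
    by (simp only: sum_distrib_left)
  finally have eq: "?Q c = c N * ?Q (\<lambda>m. 1) + (c N - c (Suc N)) * ?Q (\<lambda>m. real (N - m))
      + (\<Sum>q=1..N. ?d q * ?Q (\<lambda>m. real (q - m)))" .
  have "?d q \<ge> 0" if "q \<in> {1..N}" for q
    using c_conv[of "q - 1"] that by simp
  then have "(\<Sum>q=1..N. ?d q * ?Q (\<lambda>m. real (q - m))) \<ge> 0"
    by (intro sum_nonneg mult_nonneg_nonneg[OF _ window_kernel_nonneg])
  then have "0 \<le> ?Q c"
    unfolding eq using mult_nonneg_nonneg[OF c_nonneg[of N] const]
      mult_nonneg_nonneg[OF _ window_kernel_nonneg[where N = N and p = N and a = a], of "c N - c (Suc N)"] c_dec[of N]
    by linarith
  then show ?thesis by (simp add: sum_distrib_right)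
qed

text \<open>The integral of \<omega>_\<alpha> over [m k, (m+1) k], that is, the weight with which a
  step value m steps back enters the fractional integral at a node.\<close>

definition quad_weight :: "real \<Rightarrow> real \<Rightarrow> nat \<Rightarrow> real" where
  "quad_weight \<alpha> k m = k powr \<alpha> / Gamma (\<alpha> + 1) * ((real m + 1) powr \<alpha> - real m powr \<alpha>)"

lemma quad_weight_nonneg:
  assumes "0 < \<alpha>"
  shows "0 \<le> quad_weight \<alpha> k m"
  unfolding quad_weight_def using assms Gamma_real_pos[of "\<alpha> + 1"]
  by (intro mult_nonneg_nonneg divide_nonneg_nonneg) (auto intro!: powr_mono2)

lemma powr_succ_diff_decreasing:
  fixes \<alpha> x :: real
  assumes "0 < \<alpha>" "\<alpha> \<le> 1" "0 \<le> x" "x \<le> y"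
  shows "(y + 1) powr \<alpha> - y powr \<alpha> \<le> (x + 1) powr \<alpha> - x powr \<alpha>"
\<comment> \<open>The first weight needs x = 0, where z^\<alpha> is not differentiable if \<alpha> <
  1; hence derivatives are taken in the open interval only.\<close>
proof (rule DERIV_nonpos_imp_decreasing_open[OF \<open>x \<le> y\<close>])
  fix z assume "x < z" "z < y"
  then have "((\<lambda>z. (z + 1) powr \<alpha> - z powr \<alpha>) has_real_derivative
      \<alpha> * (z + 1) powr (\<alpha> - 1) - \<alpha> * z powr (\<alpha> - 1)) (at z)"
    using assms by (auto intro!: derivative_eq_intros)
  moreover have "(z + 1) powr (\<alpha> - 1) \<le> z powr (\<alpha> - 1)"
    using \<open>x < z\<close> assms by (intro powr_mono2') auto
  ultimately show "\<exists>d. ((\<lambda>z. (z + 1) powr \<alpha> - z powr \<alpha>) has_real_derivative d) (at z) \<and> d \<le> 0"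
    using assms by (intro exI conjI) (auto intro!: mult_left_mono)
next
  show "continuous_on {x..y} (\<lambda>z. (z + 1) powr \<alpha> - z powr \<alpha>)"
    using assms by (intro continuous_intros continuous_on_powr') auto
qed

text \<open>From x (x + 2) <= (x + 1)^2, raised to the power s/2 <= 0, and the inequality of
  arithmetic and geometric means. In effect this is midpoint convexity of x^s.\<close>

lemma powr_midpoint:
  fixes s x :: real
  assumes "s \<le> 0" "0 < x"
  shows "2 * (x + 1) powr s \<le> x powr s + (x + 2) powr s"
proof -
  have "(x + 1) powr s = ((x + 1)\<^sup>2) powr (s / 2)"
    using assms by (simp add: powr_powr flip: powr_numeral)
  also have "\<dots> \<le> (x * (x + 2)) powr (s / 2)"
    using assms by (intro powr_mono2') (auto simp: power2_eq_square algebra_simps add_pos_pos)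
  also have "\<dots> = x powr (s / 2) * (x + 2) powr (s / 2)"
    using assms by (simp add: powr_mult)
  finally have "2 * (x + 1) powr s \<le> 2 * x powr (s / 2) * (x + 2) powr (s / 2)" by simp
  also have "\<dots> \<le> (x powr (s / 2))\<^sup>2 + ((x + 2) powr (s / 2))\<^sup>2"
    by (rule sum_squares_bound)
  also have "\<dots> = x powr s + (x + 2) powr s"
    using assms by (simp add: power2_eq_square flip: powr_add)
  finally show ?thesis .
qed

text \<open>Convexity of the weights is a statement on third differences of z^\<alpha>. The function
  \<open>?h\<close> is minus a second difference, and the sign of its derivative is given by
  \<open>powr_midpoint\<close> with s = \<alpha> - 1.\<close>

lemma powr_third_difference:
  fixes \<alpha> x :: real
  assumes "0 < \<alpha>" "\<alpha> \<le> 1" "0 \<le> x"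
  shows "2 * (x + 2) powr \<alpha> - (x + 3) powr \<alpha> - (x + 1) powr \<alpha>
       \<le> 2 * (x + 1) powr \<alpha> - (x + 2) powr \<alpha> - x powr \<alpha>"
proof -
  let ?h = "\<lambda>z. 2 * (z + 1) powr \<alpha> - (z + 2) powr \<alpha> - z powr \<alpha>"
  have "?h (x + 1) \<le> ?h x"
  proof (rule DERIV_nonpos_imp_decreasing_open[of x "x + 1" ?h])
    fix z assume "x < z" "z < x + 1"
    then have "(?h has_real_derivative
      2 * (\<alpha> * (z + 1) powr (\<alpha> - 1)) - \<alpha> * (z + 2) powr (\<alpha> - 1) - \<alpha> * z powr (\<alpha> - 1)) (at z)"
      using assms by (auto intro!: derivative_eq_intros)
    moreover have "2 * (z + 1) powr (\<alpha> - 1) \<le> z powr (\<alpha> - 1) + (z + 2) powr (\<alpha> - 1)"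
      using \<open>x < z\<close> assms by (intro powr_midpoint) auto
    then have "\<alpha> * (2 * (z + 1) powr (\<alpha> - 1)) \<le> \<alpha> * (z powr (\<alpha> - 1) + (z + 2) powr (\<alpha> - 1))"
      using assms by (intro mult_left_mono) auto
    ultimately show "\<exists>d. (?h has_real_derivative d) (at z) \<and> d \<le> 0"
      by (intro exI conjI) (auto simp: algebra_simps)
  next
    show "continuous_on {x..x + 1} ?h"
      using assms by (intro continuous_intros continuous_on_powr') auto
  qed simp
  then show ?thesis by (simp add: algebra_simps)
qed

lemma quad_weight_decreasing:
  assumes "0 < \<alpha>" "\<alpha> \<le> 1"
  shows "quad_weight \<alpha> k (Suc m) \<le> quad_weight \<alpha> k m"
  using assms powr_succ_diff_decreasing[of \<alpha> "real m" "real m + 1"] Gamma_real_pos[of "\<alpha> + 1"]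
  by (auto simp: quad_weight_def add_ac intro!: mult_left_mono divide_right_mono)

lemma quad_weight_convex:
  assumes "0 < \<alpha>" "\<alpha> \<le> 1"
  shows "0 \<le> quad_weight \<alpha> k m - 2 * quad_weight \<alpha> k (Suc m) + quad_weight \<alpha> k (Suc (Suc m))"
proof -
  have "quad_weight \<alpha> k m - 2 * quad_weight \<alpha> k (Suc m) + quad_weight \<alpha> k (Suc (Suc m))
      = k powr \<alpha> / Gamma (\<alpha> + 1) *
        ((2 * (real m + 1) powr \<alpha> - (real m + 2) powr \<alpha> - real m powr \<alpha>)
         - (2 * (real m + 2) powr \<alpha> - (real m + 3) powr \<alpha> - (real m + 1) powr \<alpha>))"
    by (simp add: quad_weight_def algebra_simps)
  also have "\<dots> \<ge> 0"
    using powr_third_difference[of \<alpha> "real m"] assms Gamma_real_pos[of "\<alpha> + 1"]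
    by (intro mult_nonneg_nonneg divide_nonneg_nonneg) auto
  finally show ?thesis .
qed

section \<open>Sums of the weights and of their squares\<close>

lemma quad_weight_sum:
  assumes "0 < \<alpha>" "0 < k"
  shows "(\<Sum>m<n. quad_weight \<alpha> k m) = (real n * k) powr \<alpha> / Gamma (\<alpha> + 1)"
proof -
  have "(\<Sum>m<n. (real m + 1) powr \<alpha> - real m powr \<alpha>) = real n powr \<alpha>"
    by (induction n) (auto simp: add_ac)
  then show ?thesis
    using assms unfolding quad_weight_def sum_distrib_left[symmetric] by (simp add: powr_mult)
qed

lemma sum_diff_index: "(\<Sum>j=1..n. f (n - j)) = (\<Sum>m<n. f m)" for f :: "nat \<Rightarrow> real"
  by (rule sum.reindex_bij_witness[of _ "\<lambda>m. n - m" "\<lambda>j. n - j"]) auto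

text \<open>Cauchy-Schwarz for the integral of t^(\<alpha>-1) over [a, b], proved without integrals:
  \<open>?f\<close> is an antiderivative of (t^(\<alpha>-1) - c)^2 and therefore increasing. The
  case a = 0 is included because 2\<alpha> - 1 > 0.\<close>

lemma powr_diff_square_le:
  fixes \<alpha> a b :: real
  assumes "1/2 < \<alpha>" "0 \<le> a" "a < b"
  shows "(b powr \<alpha> - a powr \<alpha>)\<^sup>2 / \<alpha>\<^sup>2
      \<le> (b - a) * (b powr (2 * \<alpha> - 1) - a powr (2 * \<alpha> - 1)) / (2 * \<alpha> - 1)"
proof -
  \<comment> \<open>The mean of t^(\<alpha>-1) over [a, b], the constant for which the integral of
    (t^(\<alpha>-1) - c)^2 is smallest.\<close>
  define c where "c = (b powr \<alpha> - a powr \<alpha>) / (\<alpha> * (b - a))"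
  let ?f = "\<lambda>t. t powr (2 * \<alpha> - 1) / (2 * \<alpha> - 1) - 2 * c * (t powr \<alpha> / \<alpha>) + c\<^sup>2 * t"
  have "?f a \<le> ?f b"
  proof (rule DERIV_nonneg_imp_increasing_open[of a b ?f])
    fix t assume "a < t" "t < b"
    then have "0 < t" using assms by simp
    then have deriv: "((\<lambda>t. t powr s / s) has_real_derivative t powr (s - 1)) (at t)" if "0 < s" for s :: real
      using that \<open>0 < t\<close> by (auto intro!: derivative_eq_intros)
    from deriv[of "2 * \<alpha> - 1"] deriv[of \<alpha>]
    have "(?f has_real_derivative t powr (2 * \<alpha> - 2) - 2 * c * t powr (\<alpha> - 1) + c\<^sup>2) (at t)"
      using assms \<open>0 < t\<close> by (auto intro!: derivative_eq_intros)
    also have "t powr (2 * \<alpha> - 2) - 2 * c * t powr (\<alpha> - 1) + c\<^sup>2 = (t powr (\<alpha> - 1) - c)\<^sup>2"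
      by (simp add: power2_diff power2_eq_square algebra_simps flip: powr_add)
    finally show "\<exists>d. (?f has_real_derivative d) (at t) \<and> 0 \<le> d" by force
  next
    show "continuous_on {a..b} ?f"
      using assms by (intro continuous_intros continuous_on_powr') auto
  qed (use assms in simp)
  then have "2 * c * ((b powr \<alpha> - a powr \<alpha>) / \<alpha>) - c\<^sup>2 * (b - a)
      \<le> (b powr (2 * \<alpha> - 1) - a powr (2 * \<alpha> - 1)) / (2 * \<alpha> - 1)"
    by (simp add: algebra_simps diff_divide_distrib)
  moreover have mean: "(b powr \<alpha> - a powr \<alpha>) / \<alpha> = c * (b - a)"
    using assms by (simp add: c_def field_simps)
  ultimately have "c\<^sup>2 * (b - a) \<le> (b powr (2 * \<alpha> - 1) - a powr (2 * \<alpha> - 1)) / (2 * \<alpha> - 1)"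
    by (simp add: power2_eq_square algebra_simps)
  then have "c\<^sup>2 * (b - a) * (b - a) \<le>
      (b powr (2 * \<alpha> - 1) - a powr (2 * \<alpha> - 1)) / (2 * \<alpha> - 1) * (b - a)"
    using assms by (intro mult_right_mono) auto
  moreover have "c\<^sup>2 * (b - a) * (b - a) = (b powr \<alpha> - a powr \<alpha>)\<^sup>2 / \<alpha>\<^sup>2"
    using arg_cong[OF mean, of power2] by (simp add: power2_eq_square)
  ultimately show ?thesis by (simp add: mult.commute)
qed

text \<open>Log-convexity between \<alpha> and 2, evaluated at 1, where ln Gamma vanishes as it does
  at 2. It yields Gamma (\<alpha>+1) = \<alpha> Gamma \<alpha> >= \<alpha>, so that no Gamma factor
  survives in the bound on the squared weights.\<close>

lemma Gamma_ge_1: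
  assumes "0 < \<alpha>" "\<alpha> \<le> 1"
  shows "1 \<le> Gamma (\<alpha> :: real)"
proof -
  define s where "s = 1 / (2 - \<alpha>)"
  have s: "0 < s" "s \<le> 1" "s * (2 - \<alpha>) = 1"
    using assms by (auto simp: s_def)
  then have eq: "(1 - s) *\<^sub>R 2 + s *\<^sub>R \<alpha> = 1" by (simp add: algebra_simps)
  have "(ln \<circ> Gamma) ((1 - s) *\<^sub>R 2 + s *\<^sub>R \<alpha>)
     \<le> (1 - s) * (ln \<circ> Gamma) 2 + s * (ln \<circ> Gamma) \<alpha>"
    using assms s by (intro convex_onD[OF log_convex_Gamma_real]) auto
  moreover have "Gamma (2::real) = 1"
    using Gamma_fact[of 1, where ?'a = real] by simp
  ultimately have "0 \<le> ln (Gamma \<alpha>)"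
    unfolding eq using s by (simp add: zero_le_mult_iff)
  then show ?thesis using Gamma_real_pos[of \<alpha>] assms by simp
qed

text \<open>Divided by k this is the discrete form of the bound t^(2\<alpha>-1) / (2\<alpha>-1) on
  the integral of \<omega>_\<alpha>^2 over (0, t). Cauchy-Schwarz is applied on each cell, and the
  resulting powers telescope.\<close>

lemma quad_weight_square_sum:
  assumes "1/2 < \<alpha>" "\<alpha> \<le> 1" "0 < k"
  shows "(\<Sum>m<n. (quad_weight \<alpha> k m)\<^sup>2) \<le> k * (real n * k) powr (2 * \<alpha> - 1) / (2 * \<alpha> - 1)"
proof -
  have step: "(quad_weight \<alpha> k m)\<^sup>2 \<le> k powr (2 * \<alpha>) *
      ((real (Suc m) powr (2 * \<alpha> - 1) - real m powr (2 * \<alpha> - 1)) / (2 * \<alpha> - 1))" for m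
  proof -
    have "Gamma (\<alpha> + 1) = \<alpha> * Gamma \<alpha>"
      using Gamma_plus1[of \<alpha>] assms by (force elim: nonpos_Ints_cases)
    then have "\<alpha> \<le> Gamma (\<alpha> + 1)" using Gamma_ge_1[of \<alpha>] assms by simp
    then have "\<alpha>\<^sup>2 \<le> (Gamma (\<alpha> + 1))\<^sup>2" using assms by (intro power_mono) auto
    then have "((real (Suc m) powr \<alpha> - real m powr \<alpha>)\<^sup>2) / (Gamma (\<alpha> + 1))\<^sup>2
        \<le> ((real (Suc m) powr \<alpha> - real m powr \<alpha>)\<^sup>2) / \<alpha>\<^sup>2"
      using assms by (intro divide_left_mono) auto
    also have "\<dots> \<le> (real (Suc m) powr (2 * \<alpha> - 1) - real m powr (2 * \<alpha> - 1)) / (2 * \<alpha> - 1)"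
      using powr_diff_square_le[of \<alpha> "real m" "real (Suc m)"] assms by simp
    finally have "k powr (2 * \<alpha>) * (((real (Suc m) powr \<alpha> - real m powr \<alpha>)\<^sup>2) / (Gamma (\<alpha> + 1))\<^sup>2)
      \<le> k powr (2 * \<alpha>) * ((real (Suc m) powr (2 * \<alpha> - 1) - real m powr (2 * \<alpha> - 1)) / (2 * \<alpha> - 1))"
      by (intro mult_left_mono) auto
    moreover have "(quad_weight \<alpha> k m)\<^sup>2
        = (k powr \<alpha>)\<^sup>2 * (((real (Suc m) powr \<alpha> - real m powr \<alpha>)\<^sup>2) / (Gamma (\<alpha> + 1))\<^sup>2)"
      by (simp add: quad_weight_def power_mult_distrib power_divide add_ac)
    moreover have "(k powr \<alpha>)\<^sup>2 = k powr (2 * \<alpha>)"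
      by (simp add: power2_eq_square flip: powr_add)
    ultimately show ?thesis by simp
  qed
  have "(\<Sum>m<n. (quad_weight \<alpha> k m)\<^sup>2) \<le> (\<Sum>m<n. k powr (2 * \<alpha>) *
      ((real (Suc m) powr (2 * \<alpha> - 1) - real m powr (2 * \<alpha> - 1)) / (2 * \<alpha> - 1)))"
    by (intro sum_mono step)
  also have "\<dots> = k powr (2 * \<alpha>) * (real n powr (2 * \<alpha> - 1) / (2 * \<alpha> - 1))"
    unfolding sum_distrib_left[symmetric] sum_divide_distrib[symmetric]
    by (subst sum_lessThan_telescope) auto
  also have "k powr (2 * \<alpha>) = k * k powr (2 * \<alpha> - 1)"
    using assms powr_add[of k 1 "2 * \<alpha> - 1"] by simp
  finally show ?thesis using assms by (simp add: powr_mult mult_ac)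
qed

section \<open>Mittag-Leffler functions and a discrete fractional Gronwall inequality\<close>

lemma power_div_fact_le_exp:
  fixes w :: real
  assumes "0 \<le> w"
  shows "w ^ m / fact m \<le> exp w"
proof -
  have "(\<Sum>i\<in>{m}. w ^ i / fact i) \<le> (\<Sum>i. w ^ i / fact i)"
    using assms summable_exp[of w] by (intro sum_le_suminf) (auto simp: divide_inverse mult.commute)
  then show ?thesis by (simp add: exp_def divide_inverse mult.commute)
qed

text \<open>Since n \<alpha> >= n/2, the denominator dominates the factorial of
  \<open>n div 2\<close>, and (2|z|)^n divided by that factorial stays bounded. The factor 2 leaves
  a geometric series of ratio 1/2.\<close>

lemma summable_mittag_leffler:
  fixes z :: real
  assumes "1/2 < \<alpha>"
  shows "summable (\<lambda>n. z ^ n / Gamma (1 + real n * \<alpha>))"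
proof (rule summable_comparison_test')
  \<comment> \<open>The maximum with 1 allows the factor Y^(n mod 2) to be bounded by Y.\<close>
  define Y where "Y = max 1 (2 * \<bar>z\<bar>)"
  show "summable (\<lambda>n. Y * exp (Y\<^sup>2) * (1 / 2) ^ n :: real)"
    by (intro summable_mult summable_geometric) simp
  \<comment> \<open>Gamma is not monotone near 1. From n = 2 on the arguments to be compared are at
    least 3/2, where it increases.\<close>
  fix n :: nat assume n: "2 \<le> n"
  have "fact (n div 2) = Gamma (1 + real (n div 2))"
    by (simp add: Gamma_fact)
  also have "\<dots> \<le> Gamma (1 + real n * \<alpha>)"
  proof (cases "1 + real (n div 2) = 1 + real n * \<alpha>")
    case False
    have "real (n div 2) \<le> real n / 2" by linarith
    also have "\<dots> \<le> real n * \<alpha>" using assms n by (simp add: field_simps)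
    finally have "1 + real (n div 2) < 1 + real n * \<alpha>" using False by simp
    moreover have "1 \<le> n div 2" using n by linarith
    then have "3 / 2 \<le> 1 + real (n div 2)" by linarith
    ultimately show ?thesis using Gamma_real_strict_mono by fastforce
  qed simp
  finally have fact_le: "fact (n div 2) \<le> Gamma (1 + real n * \<alpha>)" .
  have "(2 * \<bar>z\<bar>) ^ n \<le> Y ^ n" by (intro power_mono) (auto simp: Y_def)
  also have "Y ^ n = Y ^ (n mod 2) * (Y\<^sup>2) ^ (n div 2)"
    by (metis mod_mult_div_eq power_add power_mult)
  also have "\<dots> \<le> Y ^ 1 * (Y\<^sup>2) ^ (n div 2)"
    by (intro mult_right_mono power_increasing) (auto simp: Y_def)
  finally have "(2 * \<bar>z\<bar>) ^ n / fact (n div 2) \<le> Y * ((Y\<^sup>2) ^ (n div 2) / fact (n div 2))"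
    by (simp add: divide_right_mono)
  also have "\<dots> \<le> Y * exp (Y\<^sup>2)"
    using power_div_fact_le_exp[of "Y\<^sup>2" "n div 2"] by (intro mult_left_mono) (auto simp: Y_def)
  finally have "(2 * \<bar>z\<bar>) ^ n / fact (n div 2) * (1 / 2) ^ n \<le> Y * exp (Y\<^sup>2) * (1 / 2) ^ n"
    by (intro mult_right_mono) auto
  moreover have "\<bar>z\<bar> ^ n / Gamma (1 + real n * \<alpha>) \<le> \<bar>z\<bar> ^ n / fact (n div 2)"
    using fact_le by (intro divide_left_mono) (auto intro!: mult_pos_pos Gamma_real_pos
      add_pos_nonneg mult_nonneg_nonneg order.trans[OF _ less_imp_le[OF assms]])
  ultimately show "norm (z ^ n / Gamma (1 + real n * \<alpha>)) \<le> Y * exp (Y\<^sup>2) * (1 / 2) ^ n"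
    using Gamma_real_pos[of "1 + real n * \<alpha>"] assms
    by (simp add: power_abs power_mult_distrib power_divide add_pos_nonneg)
qed

lemma mittag_leffler_mono:
  assumes "1/2 < \<alpha>" "0 \<le> z" "z \<le> z'"
  shows "mittag_leffler \<alpha> z \<le> mittag_leffler \<alpha> z'"
  unfolding mittag_leffler_def
proof (rule suminf_le)
  fix n
  have "0 < Gamma (1 + real n * \<alpha>)"
    using assms by (intro Gamma_real_pos add_pos_nonneg) auto
  then show "z ^ n / Gamma (1 + real n * \<alpha>) \<le> z' ^ n / Gamma (1 + real n * \<alpha>)"
    using assms by (intro divide_right_mono power_mono) auto
qed (use assms summable_mittag_leffler in auto)

lemma mittag_leffler_nonneg:
  assumes "1/2 < \<alpha>" "0 \<le> z"
  shows "0 \<le> mittag_leffler \<alpha> z"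
  unfolding mittag_leffler_def
proof (rule suminf_nonneg)
  fix n
  have "0 < Gamma (1 + real n * \<alpha>)"
    using assms by (intro Gamma_real_pos add_pos_nonneg) auto
  then show "0 \<le> z ^ n / Gamma (1 + real n * \<alpha>)"
    using assms by auto
qed (use assms summable_mittag_leffler in auto)

text \<open>Left-endpoint evaluation of the increasing factor \<open>x\<^sup>p\<close> bounds the Beta integral from below.\<close>

lemma beta_lower_sum:
  fixes \<alpha> p :: real
  assumes "0 < \<alpha>" "0 \<le> p" "1 \<le> m"
  shows "(\<Sum>j=1..<m. (real j / real m) powr p *
      ((1 - real j / real m) powr \<alpha> - (1 - real (Suc j) / real m) powr \<alpha>))
    \<le> \<alpha> * Beta (p + 1) \<alpha>"
proof -
  define x where "x j = real j / real m" for j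
  define f where "f t = t powr p * (1 - t) powr (\<alpha> - 1)" for t :: real
  have f_int: "(f has_integral Beta (p + 1) \<alpha>) {0..1}"
    using has_integral_Beta_real[of "p + 1" \<alpha>] assms by (simp add: f_def[abs_def])
  then have f_on: "f integrable_on {c..d}" if "0 \<le> c" "d \<le> 1" for c d
    using that by (intro integrable_on_subinterval[of f "{0..1}" c d]) (auto simp: integrable_on_def)
  have "(\<Sum>j=1..<r. x j powr p * ((1 - x j) powr \<alpha> - (1 - x (Suc j)) powr \<alpha>))
      \<le> \<alpha> * integral {0..x r} f" if "1 \<le> r" "r \<le> m" for r
    using that
  proof (induction r rule: dec_induct)
    case base
    have "0 \<le> integral {0..x 1} f"
      using assms by (intro Henstock_Kurzweil_Integration.integral_nonneg f_on) (auto simp: x_def f_def)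
    then show ?case using assms by simp
  next
    case (step r)
    have x: "0 \<le> x r" "x r \<le> x (Suc r)" "x (Suc r) \<le> 1"
      using step.hyps step.prems assms by (auto simp: x_def divide_right_mono)
    \<comment> \<open>The factor (1 - t)^(\<alpha>-1), singular at t = 1 for \<alpha> < 1, is
      integrated exactly on each cell. Its antiderivative is continuous up to the end, so
      differentiability in the interior suffices.\<close>
    have "((\<lambda>t. - ((1 - t) powr \<alpha>)) has_vector_derivative \<alpha> * (1 - t) powr (\<alpha> - 1)) (at t)"
      if "t \<in> {x r<..<x (Suc r)}" for t
      using that x assms
      by (auto intro!: derivative_eq_intros simp flip: has_real_derivative_iff_has_vector_derivative)
    then have "((\<lambda>t. \<alpha> * (1 - t) powr (\<alpha> - 1)) has_integral
        - ((1 - x (Suc r)) powr \<alpha>) - - ((1 - x r) powr \<alpha>)) {x r..x (Suc r)}"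
      using x assms by (intro fundamental_theorem_of_calculus_interior continuous_on_minus
          continuous_on_powr' continuous_on_diff continuous_on_const continuous_on_id) auto
    then have "((\<lambda>t. x r powr p * (\<alpha> * (1 - t) powr (\<alpha> - 1))) has_integral
        x r powr p * ((1 - x r) powr \<alpha> - (1 - x (Suc r)) powr \<alpha>)) {x r..x (Suc r)}"
      using has_integral_mult_right[of "\<lambda>t. \<alpha> * (1 - t) powr (\<alpha> - 1)" _ _ "x r powr p"] by simp
    moreover have "((\<lambda>t. \<alpha> * f t) has_integral \<alpha> * integral {x r..x (Suc r)} f) {x r..x (Suc r)}"
      using x by (intro has_integral_mult_right integrable_integral f_on) auto
    ultimately have "x r powr p * ((1 - x r) powr \<alpha> - (1 - x (Suc r)) powr \<alpha>)
        \<le> \<alpha> * integral {x r..x (Suc r)} f"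
    proof (rule has_integral_le)
      fix t assume t: "t \<in> {x r..x (Suc r)}"
      then have "x r powr p \<le> t powr p"
        using x assms by (intro powr_mono2) auto
      then have "x r powr p * (\<alpha> * (1 - t) powr (\<alpha> - 1)) \<le> t powr p * (\<alpha> * (1 - t) powr (\<alpha> - 1))"
        using assms by (intro mult_right_mono) auto
      then show "x r powr p * (\<alpha> * (1 - t) powr (\<alpha> - 1)) \<le> \<alpha> * f t"
        by (simp add: f_def mult_ac)
    qed
    moreover have "\<alpha> * integral {0..x (Suc r)} f = \<alpha> * integral {0..x r} f + \<alpha> * integral {x r..x (Suc r)} f"
      unfolding distrib_left[symmetric]
      using x by (subst Henstock_Kurzweil_Integration.integral_combine) (auto intro!: f_on)
    moreover have "(\<Sum>j=1..<r. x j powr p * ((1 - x j) powr \<alpha> - (1 - x (Suc j)) powr \<alpha>))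
        \<le> \<alpha> * integral {0..x r} f"
      using step.prems by (intro step.IH) simp
    ultimately show ?case
      using step.hyps by simp
  qed
  from this[of m] have "(\<Sum>j=1..<m. x j powr p * ((1 - x j) powr \<alpha> - (1 - x (Suc j)) powr \<alpha>))
      \<le> \<alpha> * integral {0..1} f"
    using assms by (simp add: x_def)
  then show ?thesis using f_int by (simp add: x_def integral_unique)
qed

text \<open>Discrete counterpart of I^\<alpha> (t^p / Gamma (1+p)) = t^(p+\<alpha>) / Gamma
  (1+p+\<alpha>), with the node j = m left out. Rescaling time to [0, 1] reduces it to the Beta
  integral.\<close>

lemma quad_weight_powr_sum:
  fixes \<alpha> p k :: real
  assumes "0 < \<alpha>" "\<alpha> \<le> 1" "0 \<le> p" "0 < k" "1 \<le> m"
  shows "(\<Sum>j=1..<m. quad_weight \<alpha> k (m - j) * (real j * k) powr p) / Gamma (1 + p)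
    \<le> (real m * k) powr (p + \<alpha>) / Gamma (1 + p + \<alpha>)"
proof -
  define B where "B = (real m * k) powr (p + \<alpha>) / Gamma (\<alpha> + 1)"
  have "0 \<le> B" using assms Gamma_real_pos[of "\<alpha> + 1"] by (simp add: B_def)
  have "quad_weight \<alpha> k (m - j) * (real j * k) powr p \<le> B * ((real j / real m) powr p *
      ((1 - real j / real m) powr \<alpha> - (1 - real (Suc j) / real m) powr \<alpha>))" if "j \<in> {1..<m}" for j
  proof -
    \<comment> \<open>The weight of index m - j belongs to the cell to the left of t_j, where t^p is
      smaller than at t_j. Monotonicity of the weights moves it to the cell [t_j, t_(j+1)], so that
      t_j becomes the left endpoint.\<close>
    have "Suc (m - Suc j) = m - j" using that by auto
    then have "quad_weight \<alpha> k (m - j) \<le> quad_weight \<alpha> k (m - Suc j)"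
      using quad_weight_decreasing[OF assms(1,2), of k "m - Suc j"] by simp
    also have "\<dots> = k powr \<alpha> / Gamma (\<alpha> + 1) * ((real m - real j) powr \<alpha> - (real m - real (Suc j)) powr \<alpha>)"
      using that by (simp add: quad_weight_def of_nat_diff)
    also have "\<dots> = (real m * k) powr \<alpha> / Gamma (\<alpha> + 1) *
        ((1 - real j / real m) powr \<alpha> - (1 - real (Suc j) / real m) powr \<alpha>)"
    proof -
      have "real m - real i = real m * (1 - real i / real m)" for i
        using assms by (simp add: field_simps)
      moreover have "0 \<le> 1 - real j / real m" "0 \<le> 1 - real (Suc j) / real m"
        using that by auto
      ultimately have "(real m - real j) powr \<alpha> = real m powr \<alpha> * (1 - real j / real m) powr \<alpha>"
        "(real m - real (Suc j)) powr \<alpha> = real m powr \<alpha> * (1 - real (Suc j) / real m) powr \<alpha>"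
        by (metis of_nat_0_le_iff powr_mult)+
      then show ?thesis using assms
        by (simp add: powr_mult algebra_simps)
    qed
    finally have "quad_weight \<alpha> k (m - j) * (real j * k) powr p \<le>
        (real m * k) powr \<alpha> / Gamma (\<alpha> + 1) *
        ((1 - real j / real m) powr \<alpha> - (1 - real (Suc j) / real m) powr \<alpha>) * (real j * k) powr p"
      by (rule mult_right_mono) simp
    moreover have "(real j * k) powr p = (real m * k) powr p * (real j / real m) powr p"
      using assms by (subst powr_mult[symmetric]) (simp add: mult.commute)
    ultimately show ?thesis by (simp add: B_def powr_add mult_ac)
  qed
  then have "(\<Sum>j=1..<m. quad_weight \<alpha> k (m - j) * (real j * k) powr p) \<le>
    (\<Sum>j=1..<m. B * ((real j / real m) powr p *
      ((1 - real j / real m) powr \<alpha> - (1 - real (Suc j) / real m) powr \<alpha>)))"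
    by (rule sum_mono)
  also have "\<dots> \<le> B * (\<alpha> * Beta (p + 1) \<alpha>)"
    unfolding sum_distrib_left[symmetric]
    using beta_lower_sum[of \<alpha> p m] assms \<open>0 \<le> B\<close> by (intro mult_left_mono) auto
  also have "\<dots> = (real m * k) powr (p + \<alpha>) / Gamma (1 + p + \<alpha>) * Gamma (1 + p)"
  proof -
    have "Gamma (\<alpha> + 1) = \<alpha> * Gamma \<alpha>"
      using Gamma_plus1[of \<alpha>] assms by (force elim: nonpos_Ints_cases)
    then show ?thesis
      using assms less_imp_neq[OF Gamma_real_pos[OF assms(1)]] by (simp add: B_def Beta_def add_ac)
  qed
  finally show ?thesis
    using assms Gamma_real_pos[of "1 + p"] by (simp add: pos_divide_le_eq)
qed

text \<open>The function A E_\<alpha>(c t^\<alpha>) solves v = A + c I^\<alpha> v. Under the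
  quadrature it is a supersolution, because each term of its series is mapped to at most the next
  one; strong induction compares y with it. The sum stops before j = m, so the implicit term has to
  be absorbed beforehand.\<close>

lemma discrete_fractional_gronwall:
  fixes y :: "nat \<Rightarrow> real"
  assumes \<alpha>: "1/2 < \<alpha>" "\<alpha> \<le> 1" and "0 < k" "0 \<le> A" "0 \<le> c"
    and y: "\<And>m. m \<in> {1..n} \<Longrightarrow> y m \<le> A + c * (\<Sum>j=1..<m. quad_weight \<alpha> k (m - j) * y j)"
    and "m \<in> {1..n}"
  shows "y m \<le> A * mittag_leffler \<alpha> (c * (real m * k) powr \<alpha>)"
  using \<open>m \<in> {1..n}\<close>
proof (induction m rule: less_induct)
  case (less m)
  define e where "e i j = (c * (real j * k) powr \<alpha>) ^ i / Gamma (1 + real i * \<alpha>)" for i j :: nat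
  have e_sums: "(\<lambda>i. e i j) sums mittag_leffler \<alpha> (c * (real j * k) powr \<alpha>)" for j
    using summable_sums[OF summable_mittag_leffler[OF \<alpha>(1), of "c * (real j * k) powr \<alpha>"]]
    by (simp add: e_def mittag_leffler_def)
  have e_powr: "e i j = c ^ i * ((real j * k) powr (real i * \<alpha>) / Gamma (1 + real i * \<alpha>))"
    if "1 \<le> j" for i j
  proof -
    have "((real j * k) powr \<alpha>) ^ i = (real j * k) powr (real i * \<alpha>)"
      using that \<open>0 < k\<close> by (subst powr_power) auto
    then show ?thesis unfolding e_def power_mult_distrib by (simp only: times_divide_eq_right)
  qed
  let ?q = "\<lambda>j. quad_weight \<alpha> k (m - j)"
  have "y m \<le> A + c * (\<Sum>j=1..<m. ?q j * y j)"
    using y less.prems by blast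
  also have "\<dots> \<le> A + c * (\<Sum>j=1..<m. ?q j * (A * mittag_leffler \<alpha> (c * (real j * k) powr \<alpha>)))"
    using less.prems \<alpha> \<open>0 \<le> c\<close>
    by (intro add_left_mono mult_left_mono sum_mono less.IH quad_weight_nonneg) auto
  also have "\<dots> = A * (1 + (\<Sum>j=1..<m. c * ?q j * mittag_leffler \<alpha> (c * (real j * k) powr \<alpha>)))"
    by (simp add: sum_distrib_left algebra_simps)
  \<comment> \<open>Two series are compared term by term, index i on the left with i + 1 on the
    right. The term \<open>e 0 m\<close> that is skipped equals 1 and accounts for the constant
    A.\<close>
  also have "\<dots> \<le> A * (1 + (mittag_leffler \<alpha> (c * (real m * k) powr \<alpha>) - e 0 m))"
  proof -
    have s1: "(\<lambda>i. \<Sum>j=1..<m. c * ?q j * e i j) sums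
        (\<Sum>j=1..<m. c * ?q j * mittag_leffler \<alpha> (c * (real j * k) powr \<alpha>))"
      by (intro sums_sum sums_mult e_sums)
    have s2: "(\<lambda>i. e (Suc i) m) sums (mittag_leffler \<alpha> (c * (real m * k) powr \<alpha>) - e 0 m)"
      using e_sums[of m] by (subst sums_Suc_iff) simp
    have le: "(\<Sum>j=1..<m. c * ?q j * e i j) \<le> e (Suc i) m" for i
    proof -
      have "(\<Sum>j=1..<m. c * ?q j * e i j) = c ^ Suc i *
          ((\<Sum>j=1..<m. ?q j * (real j * k) powr (real i * \<alpha>)) / Gamma (1 + real i * \<alpha>))"
        by (simp add: e_powr sum_distrib_left sum_divide_distrib mult_ac)
      also have "\<dots> \<le> c ^ Suc i *
          ((real m * k) powr (real i * \<alpha> + \<alpha>) / Gamma (1 + real i * \<alpha> + \<alpha>))"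
        using \<alpha> \<open>0 < k\<close> \<open>0 \<le> c\<close> less.prems by (intro mult_left_mono quad_weight_powr_sum) auto
      also have "\<dots> = e (Suc i) m"
        using less.prems by (subst e_powr) (auto simp: algebra_simps)
      finally show ?thesis .
    qed
    from sums_le[OF le s1 s2]
    show ?thesis using \<open>0 \<le> A\<close> by (intro mult_left_mono) auto
  qed
  also have "\<dots> = A * mittag_leffler \<alpha> (c * (real m * k) powr \<alpha>)"
    by (simp add: e_def)
  finally show ?case .
qed

section \<open>Fractional derivatives of piecewise constant functions\<close>

text \<open>The extension by 0 to t <= 0 lets one formula serve every pair of a time and a node,
  whichever comes first.\<close>

definition pos_omega :: "real \<Rightarrow> real \<Rightarrow> real" where
  "pos_omega \<alpha> t = (if 0 < t then omega \<alpha> t else 0)"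

text \<open>The antiderivative \<omega>_(\<alpha>+1) of \<open>pos_omega\<close>, again extended by
  0. For 0 < \<alpha> <= 1 it is continuous at 0 while the kernel is not.\<close>

definition pos_omega_integral :: "real \<Rightarrow> real \<Rightarrow> real" where
  "pos_omega_integral \<alpha> t = max 0 t powr \<alpha> / Gamma (\<alpha> + 1)"

lemma pos_omega_nonneg: "0 < \<alpha> \<Longrightarrow> 0 \<le> pos_omega \<alpha> t"
  using Gamma_real_pos[of \<alpha>] by (simp add: pos_omega_def omega_def)

lemma borel_measurable_pos_omega [measurable]: "pos_omega \<alpha> \<in> borel_measurable borel"
  unfolding pos_omega_def[abs_def] omega_def by measurable

lemma DERIV_pos_omega_integral:
  assumes "0 < \<alpha>" "t \<noteq> 0"
  shows "(pos_omega_integral \<alpha> has_real_derivative pos_omega \<alpha> t) (at t)"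
proof (cases "0 < t")
  case True
  have "0 < Gamma \<alpha>" using assms by (intro Gamma_real_pos)
  have "((\<lambda>t. t powr \<alpha> / Gamma (\<alpha> + 1)) has_real_derivative \<alpha> * t powr (\<alpha> - 1) / Gamma (\<alpha> + 1)) (at t)"
    by (intro DERIV_cdivide has_real_derivative_powr True)
  also have "Gamma (\<alpha> + 1) = \<alpha> * Gamma \<alpha>"
    using Gamma_plus1[of \<alpha>] assms by (force elim: nonpos_Ints_cases)
  also have "\<alpha> * t powr (\<alpha> - 1) / (\<alpha> * Gamma \<alpha>) = pos_omega \<alpha> t"
    using True assms by (simp add: pos_omega_def omega_def)
  finally have "((\<lambda>t. t powr \<alpha> / Gamma (\<alpha> + 1)) has_real_derivative pos_omega \<alpha> t) (at t)"
    using \<open>Gamma (\<alpha> + 1) = \<alpha> * Gamma \<alpha>\<close> by simp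
  then show ?thesis
    by (rule has_field_derivative_transform_within_open[where S = "{0<..}"])
      (use True in \<open>auto simp: pos_omega_integral_def\<close>)
next
  case False
  have "((\<lambda>t. 0) has_real_derivative pos_omega \<alpha> t) (at t)"
    using False by (simp add: pos_omega_def)
  then show ?thesis
    by (rule has_field_derivative_transform_within_open[where S = "{..<0}"])
      (use False assms in \<open>auto simp: pos_omega_integral_def\<close>)
qed

lemma continuous_on_pos_omega_integral:
  assumes "0 < \<alpha>"
  shows "continuous_on S (pos_omega_integral \<alpha>)"
  unfolding pos_omega_integral_def[abs_def] using assms less_imp_neq[OF Gamma_real_pos[of "\<alpha> + 1"]]
  by (intro continuous_on_divide continuous_on_powr' continuous_on_max continuous_on_const
      continuous_on_id) auto

text \<open>The kernel blows up at one point when \<alpha> < 1. The fundamental theorem for the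
  gauge integral tolerates a finite exceptional set, and nonnegativity of f turns gauge
  integrability into Lebesgue integrability.\<close>

lemma has_bochner_integral_FTC_nonneg_except_finite:
  fixes f G :: "real \<Rightarrow> real"
  assumes "finite S" "a \<le> b" "continuous_on {a..b} G"
    and "\<And>t. t \<in> {a<..<b} - S \<Longrightarrow> (G has_real_derivative f t) (at t)"
    and [measurable]: "f \<in> borel_measurable borel" and "\<And>t. 0 \<le> f t"
  shows "has_bochner_integral lborel (\<lambda>t. indicator {a..b} t * f t) (G b - G a)"
proof -
  have int: "(f has_integral (G b - G a)) {a..b}"
    using assms
    by (intro fundamental_theorem_of_calculus_interior_strong[of S])
      (auto simp: has_real_derivative_iff_has_vector_derivative)
  then have "f absolutely_integrable_on {a..b}"
    using assms by (intro nonnegative_absolutely_integrable_1) auto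
  then have "set_integrable lborel {a..b} f"
    unfolding set_integrable_def
    by (subst (asm) integrable_completion) (auto simp: set_borel_measurable_def)
  moreover have "(LINT t:{a..b}|lborel. f t) = G b - G a"
    using set_borel_integral_eq_integral(2)[OF calculation] int by (simp add: integral_unique)
  ultimately show ?thesis
    by (simp add: has_bochner_integral_iff set_integrable_def set_lebesgue_integral_def)
qed

lemma has_bochner_integral_pos_omega:
  assumes "0 < \<alpha>" "a \<le> b"
  shows "has_bochner_integral lborel (\<lambda>t. indicator {a..b} t * pos_omega \<alpha> (t - c))
    (pos_omega_integral \<alpha> (b - c) - pos_omega_integral \<alpha> (a - c))"
proof (rule has_bochner_integral_FTC_nonneg_except_finite[of "{c}" _ _ "\<lambda>t. pos_omega_integral \<alpha> (t - c)"])
  fix t assume "t \<in> {a<..<b} - {c}"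
  then have "((\<lambda>t. pos_omega_integral \<alpha> (t - c)) has_real_derivative pos_omega \<alpha> (t - c) * (1 - 0)) (at t)"
    using assms by (intro DERIV_chain2[OF DERIV_pos_omega_integral]) (auto intro!: derivative_eq_intros)
  then show "((\<lambda>t. pos_omega_integral \<alpha> (t - c)) has_real_derivative pos_omega \<alpha> (t - c)) (at t)"
    by simp
next
  show "continuous_on {a..b} (\<lambda>t. pos_omega_integral \<alpha> (t - c))"
    using assms by (intro continuous_on_compose2[OF continuous_on_pos_omega_integral[where S = UNIV]])
      (auto intro!: continuous_intros)
qed (use assms pos_omega_nonneg in auto)

text \<open>Integration in the memory variable s, for the fractional integral itself; the version in
  t serves to integrate the fractional derivative over a step.\<close>

lemma has_bochner_integral_pos_omega_reflected:
  assumes "0 < \<alpha>" "a \<le> b"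
  shows "has_bochner_integral lborel (\<lambda>s. indicator {a..b} s * pos_omega \<alpha> (t - s))
    (pos_omega_integral \<alpha> (t - a) - pos_omega_integral \<alpha> (t - b))"
proof -
  have "has_bochner_integral lborel (\<lambda>s. indicator {a..b} s * pos_omega \<alpha> (t - s))
    (- pos_omega_integral \<alpha> (t - b) - - pos_omega_integral \<alpha> (t - a))"
  proof (rule has_bochner_integral_FTC_nonneg_except_finite[of "{t}" _ _ "\<lambda>s. - pos_omega_integral \<alpha> (t - s)"])
    fix s assume "s \<in> {a<..<b} - {t}"
    then have "((\<lambda>s. - pos_omega_integral \<alpha> (t - s)) has_real_derivative
        - (pos_omega \<alpha> (t - s) * (0 - 1))) (at s)"
      using assms by (intro DERIV_minus DERIV_chain2[OF DERIV_pos_omega_integral])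
        (auto intro!: derivative_eq_intros)
    then show "((\<lambda>s. - pos_omega_integral \<alpha> (t - s)) has_real_derivative pos_omega \<alpha> (t - s)) (at s)"
      by simp
  next
    show "continuous_on {a..b} (\<lambda>s. - pos_omega_integral \<alpha> (t - s))"
      using assms by (intro continuous_on_minus
          continuous_on_compose2[OF continuous_on_pos_omega_integral[where S = UNIV]])
        (auto intro!: continuous_intros)
  qed (use assms pos_omega_nonneg in auto)
  then show ?thesis by simp
qed

section \<open>Explicit formulas for step functions\<close>

lemma pw_const_eq_sum:
  assumes "0 < k" "0 < s" "s \<le> real n * k"
  shows "pw_const k v s = (\<Sum>j=1..n. indicator {real (j - 1) * k<..real j * k} s * v j)"
proof -
  define i where "i = nat \<lceil>s / k\<rceil>"
  have "0 < s / k" using assms by simp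
  then have i: "real i - 1 < s / k" "s / k \<le> real i" "1 \<le> i"
    unfolding i_def by linarith+
  then have i_mult: "(real i - 1) * k < s" "s \<le> real i * k"
    using assms by (auto simp: pos_less_divide_eq pos_divide_le_eq)
  have "s / k \<le> real n" using assms by (simp add: pos_divide_le_eq)
  then have "i \<le> n" using i by linarith
  have "s \<in> {real (j - 1) * k<..real j * k} \<longleftrightarrow> j = i" if "j \<in> {1..n}" for j
  proof
    assume "s \<in> {real (j - 1) * k<..real j * k}"
    then have "real j - 1 < s / k" "s / k \<le> real j"
      using that assms by (auto simp: pos_less_divide_eq pos_divide_le_eq of_nat_diff)
    then show "j = i" using i by linarith
  qed (use i i_mult in \<open>auto simp: of_nat_diff\<close>)
  then have "(\<Sum>j=1..n. indicator {real (j - 1) * k<..real j * k} s * v j)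
      = (\<Sum>j=1..n. if j = i then v j else 0)"
    by (intro sum.cong) (auto simp: indicator_def)
  also have "\<dots> = v i" using i \<open>i \<le> n\<close> by simp
  finally show ?thesis by (simp add: pw_const_def i_def)
qed

text \<open>Cells beyond t contribute 0 by the causal extension, so every n with t <= n k is
  allowed. One formula thus holds on a whole neighbourhood of a time and can be differentiated
  there.\<close>

lemma frac_integral_pw_const:
  assumes "0 < \<alpha>" "0 < k" "t \<le> real n * k"
  shows "frac_integral \<alpha> (pw_const k v) t = (\<Sum>j=1..n. v j *
    (pos_omega_integral \<alpha> (t - real (j - 1) * k) - pos_omega_integral \<alpha> (t - real j * k)))"
proof -
  let ?g = "\<lambda>s. \<Sum>j=1..n. v j * (indicator {real (j - 1) * k..real j * k} s * pos_omega \<alpha> (t - s))"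
  \<comment> \<open>The nodes, which neighbouring closed cells share, and the point s = t of the
    singularity; a countable set does not affect the integral.\<close>
  define X where "X = insert t (range (\<lambda>j. real j * k))"
  have "countable X" by (simp add: X_def)
  have eq: "?g s = indicator {0..t} s *\<^sub>R (omega \<alpha> (t - s) * pw_const k v s)" if "s \<notin> X" for s
  proof (cases "0 < s \<and> s < t")
    case True
    have nodes: "s \<noteq> real j * k" for j using that by (auto simp: X_def)
    have ind: "indicator {real (j - 1) * k..real j * k} s = (indicator {real (j - 1) * k<..real j * k} s :: real)" for j
      using nodes[of "j - 1"] by (auto simp: indicator_def less_le)
    then have "?g s = (\<Sum>j=1..n. indicator {real (j - 1) * k<..real j * k} s * v j) * pos_omega \<alpha> (t - s)"
      unfolding sum_distrib_right ind by (simp only: mult_ac)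
    also have "(\<Sum>j=1..n. indicator {real (j - 1) * k<..real j * k} s * v j) = pw_const k v s"
      using assms True by (intro pw_const_eq_sum[symmetric]) auto
    finally show ?thesis
      using True by (simp add: pos_omega_def)
  next
    case False
    have "indicator {real (j - 1) * k..real j * k} s = (0::real)" if "s < 0" for j
    proof -
      have "0 \<le> real (j - 1) * k" using assms by simp
      then have "s < real (j - 1) * k" using that by linarith
      then show ?thesis by simp
    qed
    moreover have "s \<noteq> 0" "s \<noteq> t" using that by (auto simp: X_def image_iff dest: spec[of _ 0])
    ultimately show ?thesis
      using False by (cases "s < 0") (auto simp: pos_omega_def simp del: of_nat_diff)
  qed
  have "has_bochner_integral lborel ?g
    (\<Sum>j=1..n. v j *
      (pos_omega_integral \<alpha> (t - real (j - 1) * k) - pos_omega_integral \<alpha> (t - real j * k)))"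
    using assms by (intro has_bochner_integral_sum has_bochner_integral_mult_right
        has_bochner_integral_pos_omega_reflected mult_right_mono) auto
  then have "has_bochner_integral lborel
      (\<lambda>s. indicator {0..t} s *\<^sub>R (omega \<alpha> (t - s) * pw_const k v s))
    (\<Sum>j=1..n. v j *
      (pos_omega_integral \<alpha> (t - real (j - 1) * k) - pos_omega_integral \<alpha> (t - real j * k)))"
    using eq \<open>countable X\<close>
    by (subst has_bochner_integral_discrete_difference[where X = X and g = ?g]) auto
  then show ?thesis
    by (simp add: frac_integral_def set_lebesgue_integral_def has_bochner_integral_integral_eq)
qed

text \<open>Strictly inside a step every t - j k is nonzero, so each term is differentiable. At a
  node the derivative may fail to exist, but nodes form a null set for the integrals over
  steps.\<close>

lemma frac_deriv_pw_const:
  assumes "0 < \<alpha>" "0 < k" "real (n - 1) * k < t" "t < real n * k"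
  shows "frac_deriv \<alpha> (pw_const k v) t = (\<Sum>j=1..n. v j *
    (pos_omega \<alpha> (t - real (j - 1) * k) - pos_omega \<alpha> (t - real j * k)))"
proof -
  let ?I = "\<lambda>s. \<Sum>j=1..n. v j *
    (pos_omega_integral \<alpha> (s - real (j - 1) * k) - pos_omega_integral \<alpha> (s - real j * k))"
  have node: "((\<lambda>s. pos_omega_integral \<alpha> (s - real j * k)) has_real_derivative pos_omega \<alpha> (t - real j * k)) (at t)"
    if "j \<le> n" for j
  proof -
    have "t \<noteq> real j * k"
    proof (cases "j = n")
      case False
      then have "real j * k \<le> real (n - 1) * k"
        using that assms by (intro mult_right_mono) auto
      then show ?thesis using assms(3) by linarith
    qed (use assms in simp)
    then have "((\<lambda>s. pos_omega_integral \<alpha> (s - real j * k)) has_real_derivative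
        pos_omega \<alpha> (t - real j * k) * (1 - 0)) (at t)"
      using assms by (intro DERIV_chain2[OF DERIV_pos_omega_integral]) (auto intro!: derivative_eq_intros)
    then show ?thesis by simp
  qed
  have "(?I has_real_derivative (\<Sum>j=1..n. v j *
    (pos_omega \<alpha> (t - real (j - 1) * k) - pos_omega \<alpha> (t - real j * k)))) (at t)"
    using node by (intro DERIV_sum DERIV_cmult DERIV_diff) (auto simp del: of_nat_diff)
  then have "(frac_integral \<alpha> (pw_const k v) has_real_derivative (\<Sum>j=1..n. v j *
    (pos_omega \<alpha> (t - real (j - 1) * k) - pos_omega \<alpha> (t - real j * k)))) (at t)"
    by (rule has_field_derivative_transform_within_open[where S = "{..<real n * k}"])
      (use assms frac_integral_pw_const[OF assms(1,2), of _ n v] in auto)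
  then show ?thesis by (simp add: frac_deriv_def DERIV_imp_deriv)
qed

lemma pos_omega_integral_step:
  assumes "0 < k"
  shows "pos_omega_integral \<alpha> (real (Suc m) * k) - pos_omega_integral \<alpha> (real m * k) = quad_weight \<alpha> k m"
proof -
  have "(real (Suc m) * k) powr \<alpha> = real (Suc m) powr \<alpha> * k powr \<alpha>"
    "(real m * k) powr \<alpha> = real m powr \<alpha> * k powr \<alpha>"
    using assms by (auto simp only: powr_mult less_imp_le of_nat_0_le_iff)
  moreover have "0 \<le> real (Suc m) * k" "0 \<le> real m * k" using assms by auto
  ultimately show ?thesis
    by (simp add: pos_omega_integral_def quad_weight_def diff_divide_distrib algebra_simps max_absorb2)
qed

text \<open>The integral is the increment of the fractional integral between two nodes. Shifting the
  index at the earlier node pairs v j with v (j - 1) under one weight. The leftover carries v 0,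
  although \<open>pw_const\<close> never takes that value at positive times.\<close>

lemma integral_frac_deriv_pw_const:
  assumes "0 < \<alpha>" "0 < k" "1 \<le> n"
  shows "(LINT t:{real (n - 1) * k..real n * k}|lborel. frac_deriv \<alpha> (pw_const k v) t)
    = (\<Sum>j=1..n. quad_weight \<alpha> k (n - j) * (v j - v (j - 1))) + quad_weight \<alpha> k (n - 1) * v 0"
proof -
  let ?I = "{real (n - 1) * k..real n * k}" and ?P = "pos_omega_integral \<alpha>"
  have le: "real (n - 1) * k \<le> real n * k" using assms by (intro mult_right_mono) auto
  let ?g = "\<lambda>t. \<Sum>j=1..n. v j * (indicator ?I t * pos_omega \<alpha> (t - real (j - 1) * k)
      - indicator ?I t * pos_omega \<alpha> (t - real j * k))"
  have "has_bochner_integral lborel ?g (\<Sum>j=1..n. v j *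
      ((?P (real n * k - real (j - 1) * k) - ?P (real (n - 1) * k - real (j - 1) * k))
      - (?P (real n * k - real j * k) - ?P (real (n - 1) * k - real j * k))))"
    using assms le by (intro has_bochner_integral_sum has_bochner_integral_mult_right
        has_bochner_integral_diff has_bochner_integral_pos_omega) auto
  moreover have "?g t = indicator ?I t *\<^sub>R frac_deriv \<alpha> (pw_const k v) t"
    if "t \<notin> {real (n - 1) * k, real n * k}" for t
  proof (cases "t \<in> ?I")
    case True
    with that frac_deriv_pw_const[OF assms(1,2), of n t v] show ?thesis by (auto simp del: of_nat_diff)
  qed simp
  ultimately have "has_bochner_integral lborel (\<lambda>t. indicator ?I t *\<^sub>R frac_deriv \<alpha> (pw_const k v) t)
    (\<Sum>j=1..n. v j *
      ((?P (real n * k - real (j - 1) * k) - ?P (real (n - 1) * k - real (j - 1) * k))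
      - (?P (real n * k - real j * k) - ?P (real (n - 1) * k - real j * k))))"
    by (subst has_bochner_integral_discrete_difference
        [where X = "{real (n - 1) * k, real n * k}" and g = ?g]) auto
  then have "(LINT t:?I|lborel. frac_deriv \<alpha> (pw_const k v) t) = (\<Sum>j=1..n. v j *
      ((?P (real n * k - real (j - 1) * k) - ?P (real (n - 1) * k - real (j - 1) * k))
      - (?P (real n * k - real j * k) - ?P (real (n - 1) * k - real j * k))))"
    unfolding set_lebesgue_integral_def by (rule has_bochner_integral_integral_eq)
  \<comment> \<open>At the earlier node cell n does not contribute. It is treated separately, as the
    truncated index n - 1 - n would produce the weight of index 0.\<close>
  also have "\<dots> = (\<Sum>j=1..n. quad_weight \<alpha> k (n - j) * v j)
      - (\<Sum>j=1..n. (if j = n then 0 else quad_weight \<alpha> k (n - 1 - j)) * v j)"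
    unfolding sum_subtractf[symmetric]
  proof (intro sum.cong refl)
    fix j assume j: "j \<in> {1..n}"
    have 1: "?P (real n * k - real (j - 1) * k) - ?P (real n * k - real j * k) = quad_weight \<alpha> k (n - j)"
      using j pos_omega_integral_step[OF assms(2), of \<alpha> "n - j"]
      by (simp add: of_nat_diff algebra_simps)
    have 2: "?P (real (n - 1) * k - real (j - 1) * k) - ?P (real (n - 1) * k - real j * k)
        = (if j = n then 0 else quad_weight \<alpha> k (n - 1 - j))"
    proof (cases "j = n")
      case True
      then show ?thesis using assms by (simp add: pos_omega_integral_def of_nat_diff algebra_simps)
    next
      case False
      then show ?thesis
        using j pos_omega_integral_step[OF assms(2), of \<alpha> "n - 1 - j"]
        by (simp add: of_nat_diff algebra_simps)
    qed
    show "v j * ((?P (real n * k - real (j - 1) * k) - ?P (real (n - 1) * k - real (j - 1) * k))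
      - (?P (real n * k - real j * k) - ?P (real (n - 1) * k - real j * k)))
      = quad_weight \<alpha> k (n - j) * v j - (if j = n then 0 else quad_weight \<alpha> k (n - 1 - j)) * v j"
      unfolding 1[symmetric] 2[symmetric] by (simp add: algebra_simps)
  qed
  finally have 1: "(LINT t:?I|lborel. frac_deriv \<alpha> (pw_const k v) t)
      = (\<Sum>j=1..n. quad_weight \<alpha> k (n - j) * v j)
      - (\<Sum>j=1..n. (if j = n then 0 else quad_weight \<alpha> k (n - 1 - j)) * v j)" .
  have 2: "(\<Sum>j=1..n. (if j = n then 0 else quad_weight \<alpha> k (n - 1 - j)) * v j)
      = (\<Sum>j=1..n. quad_weight \<alpha> k (n - j) * v (j - 1)) - quad_weight \<alpha> k (n - 1) * v 0"
  proof -
    obtain m where n: "n = Suc m" using assms(3) by (cases n) auto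
    have "(\<Sum>j=1..n. quad_weight \<alpha> k (n - j) * v (j - 1)) = (\<Sum>j=0..m. quad_weight \<alpha> k (m - j) * v j)"
      unfolding n by (rule sum.reindex_bij_witness[of _ Suc "\<lambda>j. j - 1"]) auto
    also have "\<dots> = quad_weight \<alpha> k m * v 0 + (\<Sum>j=1..m. quad_weight \<alpha> k (m - j) * v j)"
      by (simp add: sum.atLeast_Suc_atMost)
    finally have 3: "(\<Sum>j=1..n. quad_weight \<alpha> k (n - j) * v (j - 1))
        = quad_weight \<alpha> k m * v 0 + (\<Sum>j=1..m. quad_weight \<alpha> k (m - j) * v j)" .
    have 4: "(\<Sum>j=1..m. quad_weight \<alpha> k (m - j) * v j)
        = (\<Sum>j=1..n. (if j = n then 0 else quad_weight \<alpha> k (n - 1 - j)) * v j)"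
      unfolding n by simp
    show ?thesis using 3 unfolding 4 by (simp add: n)
  qed
  show ?thesis
    unfolding 1 2 right_diff_distrib sum_subtractf by linarith
qed

section \<open>Square-integrable functions and test functions\<close>

lemma L2_add: "u \<in> L2 L \<Longrightarrow> v \<in> L2 L \<Longrightarrow> (\<lambda>x. u x + v x) \<in> L2 L"
proof -
  assume u: "u \<in> L2 L" and v: "v \<in> L2 L"
  have [measurable]: "u \<in> borel_measurable (Omega L)" "v \<in> borel_measurable (Omega L)"
    using u v by (auto simp: L2_def)
  have "integrable (Omega L) (\<lambda>x. 2 * (u x)\<^sup>2 + 2 * (v x)\<^sup>2)"
    using u v by (auto simp: L2_def)
  then have "integrable (Omega L) (\<lambda>x. (u x + v x)\<^sup>2)"
  proof (rule Bochner_Integration.integrable_bound)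
    have "(u x + v x)\<^sup>2 \<le> 2 * (u x)\<^sup>2 + 2 * (v x)\<^sup>2" for x
      using zero_le_power2[of "u x - v x"] by (simp add: power2_eq_square algebra_simps)
    then show "AE x in Omega L. norm ((u x + v x)\<^sup>2) \<le> norm (2 * (u x)\<^sup>2 + 2 * (v x)\<^sup>2)"
      by simp
  qed measurable
  then show ?thesis by (simp add: L2_def)
qed

lemma L2_cmult: "u \<in> L2 L \<Longrightarrow> (\<lambda>x. c * u x) \<in> L2 L"
  by (auto simp: L2_def power_mult_distrib)

lemma L2_diff: "u \<in> L2 L \<Longrightarrow> v \<in> L2 L \<Longrightarrow> (\<lambda>x. u x - v x) \<in> L2 L"
  using L2_add[of u L "\<lambda>x. -1 * v x"] L2_cmult[of v L "-1"] by simp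

lemma L2_zero: "(\<lambda>x. 0) \<in> L2 L"
  by (simp add: L2_def)

lemma L2_sum: "(\<And>j. j \<in> S \<Longrightarrow> u j \<in> L2 L) \<Longrightarrow> (\<lambda>x. \<Sum>j\<in>S. u j x) \<in> L2 L"
  by (induction S rule: infinite_finite_induct) (auto intro: L2_add L2_zero)

lemma L2_bounded_mult:
  assumes f [measurable]: "f \<in> borel_measurable (Omega L)" and B: "\<And>x. 0 < x \<Longrightarrow> x < L \<Longrightarrow> \<bar>f x\<bar> \<le> B"
    and u: "u \<in> L2 L"
  shows "(\<lambda>x. f x * u x) \<in> L2 L"
proof -
  have [measurable]: "u \<in> borel_measurable (Omega L)"
    using u by (auto simp: L2_def)
  have "integrable (Omega L) (\<lambda>x. B\<^sup>2 * (u x)\<^sup>2)"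
    using u by (auto simp: L2_def)
  then have "integrable (Omega L) (\<lambda>x. (f x * u x)\<^sup>2)"
  proof (rule Bochner_Integration.integrable_bound)
    show "AE x in Omega L. norm ((f x * u x)\<^sup>2) \<le> norm (B\<^sup>2 * (u x)\<^sup>2)"
    proof (rule AE_I2)
      fix x assume "x \<in> space (Omega L)"
      then have "\<bar>f x\<bar> \<le> B" using B by auto
      then have "(f x)\<^sup>2 \<le> B\<^sup>2" by (rule power2_le_iff_abs_le[THEN iffD2, rotated]) (use \<open>\<bar>f x\<bar> \<le> B\<close> in linarith)
      then show "norm ((f x * u x)\<^sup>2) \<le> norm (B\<^sup>2 * (u x)\<^sup>2)"
        by (simp add: power_mult_distrib mult_right_mono)
    qed
  qed measurable
  then show ?thesis by (simp add: L2_def)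
qed

lemma integrable_L2_mult:
  assumes u: "u \<in> L2 L" and v: "v \<in> L2 L"
  shows "integrable (Omega L) (\<lambda>x. u x * v x)"
proof -
  have [measurable]: "u \<in> borel_measurable (Omega L)" "v \<in> borel_measurable (Omega L)"
    using u v by (auto simp: L2_def)
  have "integrable (Omega L) (\<lambda>x. (u x)\<^sup>2 + (v x)\<^sup>2)"
    using u v by (auto simp: L2_def)
  then show ?thesis
  proof (rule Bochner_Integration.integrable_bound)
    have "\<bar>u x * v x\<bar> \<le> (u x)\<^sup>2 + (v x)\<^sup>2" for x
    proof -
      have "2 * (\<bar>u x\<bar> * \<bar>v x\<bar>) \<le> \<bar>u x\<bar>\<^sup>2 + \<bar>v x\<bar>\<^sup>2"
        using sum_squares_bound[of "\<bar>u x\<bar>" "\<bar>v x\<bar>"] by simp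
      moreover have "0 \<le> \<bar>u x\<bar> * \<bar>v x\<bar>" by simp
      ultimately show ?thesis by (simp add: abs_mult del: zero_le_mult_iff mult_nonneg_nonneg)
    qed
    then show "AE x in Omega L. norm (u x * v x) \<le> norm ((u x)\<^sup>2 + (v x)\<^sup>2)"
      by simp
  qed measurable
qed

lemma L2_norm_square:
  "(L2_norm L u)\<^sup>2 = (\<integral>x. (u x)\<^sup>2 \<partial>Omega L)"
  unfolding L2_norm_def by (simp add: integral_nonneg_AE)

text \<open>\<open>regular_distr\<close> doubles as the inner product of L2, and this is
  Cauchy-Schwarz by the discriminant of a quadratic in t.\<close>

lemma abs_regular_distr_le:
  assumes u: "u \<in> L2 L" and v: "v \<in> L2 L"
  shows "\<bar>regular_distr L u v\<bar> \<le> L2_norm L u * L2_norm L v"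
proof -
  define A B I where "A = (L2_norm L u)\<^sup>2" and "B = (L2_norm L v)\<^sup>2" and "I = regular_distr L u v"
  have quad: "0 \<le> t\<^sup>2 * A - 2 * t * I + B" for t
  proof -
    have "0 \<le> (\<integral>x. (t * u x - v x)\<^sup>2 \<partial>Omega L)" by (simp add: integral_nonneg_AE)
    also have "\<dots> = (\<integral>x. t\<^sup>2 * (u x)\<^sup>2 - (2 * t) * (u x * v x) + (v x)\<^sup>2 \<partial>Omega L)"
      by (intro Bochner_Integration.integral_cong) (auto simp: power2_eq_square algebra_simps)
    also have "\<dots> = t\<^sup>2 * A - 2 * t * I + B"
      using u v integrable_L2_mult[OF u v]
      by (simp add: A_def B_def I_def L2_norm_square regular_distr_def L2_def)
    finally show ?thesis .
  qed
  have "I\<^sup>2 \<le> A * B"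
  proof (cases "A = 0")
    case True
    have "I = 0"
    proof (rule ccontr)
      assume "I \<noteq> 0"
      \<comment> \<open>For A = 0 the quadratic is linear in t, and at this t it has the value
        -1.\<close>
      with quad[of "(B + 1) / (2 * I)"] True show False by simp
    qed
    then show ?thesis by (simp add: A_def B_def)
  next
    case False
    then have "0 < A" by (simp add: A_def)
    moreover have "(I / A)\<^sup>2 * A = I\<^sup>2 / A" "2 * (I / A) * I = 2 * (I\<^sup>2 / A)"
      using \<open>0 < A\<close> by (auto simp: power2_eq_square)
    ultimately have "I\<^sup>2 / A \<le> B" using quad[of "I / A"] by linarith
    then show ?thesis using \<open>0 < A\<close> by (simp add: pos_divide_le_eq mult.commute)
  qed
  then have "\<bar>I\<bar>\<^sup>2 \<le> (L2_norm L u * L2_norm L v)\<^sup>2"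
    by (simp add: A_def B_def power_mult_distrib)
  then show ?thesis
    unfolding I_def by (rule power2_le_imp_le) (simp add: L2_norm_def integral_nonneg_AE)
qed

lemma regular_distr_add:
  assumes "u \<in> L2 L" "v \<in> L2 L" "w \<in> L2 L"
  shows "regular_distr L (\<lambda>x. u x + v x) w = regular_distr L u w + regular_distr L v w"
  using assms by (simp add: regular_distr_def distrib_right integrable_L2_mult)

lemma regular_distr_diff:
  assumes "u \<in> L2 L" "v \<in> L2 L" "w \<in> L2 L"
  shows "regular_distr L (\<lambda>x. u x - v x) w = regular_distr L u w - regular_distr L v w"
  using assms by (simp add: regular_distr_def left_diff_distrib integrable_L2_mult)

lemma regular_distr_cmult: "regular_distr L (\<lambda>x. c * u x) w = c * regular_distr L u w"
  by (simp add: regular_distr_def mult.assoc)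

lemma regular_distr_commute: "regular_distr L u v = regular_distr L v u"
  by (simp add: regular_distr_def mult.commute)

lemma regular_distr_sum:
  assumes "\<And>j. j \<in> S \<Longrightarrow> u j \<in> L2 L" "w \<in> L2 L"
  shows "regular_distr L (\<lambda>x. \<Sum>j\<in>S. c j * u j x) w = (\<Sum>j\<in>S. c j * regular_distr L (u j) w)"
  using assms
  by (simp add: regular_distr_def sum_distrib_right mult.assoc integrable_L2_mult)

lemma test_functions_has_deriv:
  assumes "\<phi> \<in> test_functions L"
  shows "(\<phi> has_real_derivative deriv \<phi> x) (at x)"
proof -
  have "(deriv ^^ 0) \<phi> differentiable_on UNIV"
    using assms unfolding test_functions_def by blast
  then have "\<phi> differentiable at x" by (simp add: differentiable_on_def)
  then show ?thesis using DERIV_deriv_iff_real_differentiable by blast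
qed

lemma test_functions_support:
  assumes "\<phi> \<in> test_functions L" "0 < L"
  obtains a b where "0 < a" "a \<le> b" "b < L" "\<And>x. x \<notin> {a..b} \<Longrightarrow> \<phi> x = 0" "\<And>x. x \<notin> {a..b} \<Longrightarrow> deriv \<phi> x = 0"
proof -
  obtain a b where ab: "0 < a" "b < L" "\<And>x. x \<notin> {a..b} \<Longrightarrow> \<phi> x = 0"
    using assms(1) unfolding test_functions_def by blast
  \<comment> \<open>The interval in the definition of a test function may be empty; including the
    midpoint L/2 ensures a' <= b'.\<close>
  define a' b' where "a' = min a (L / 2)" and "b' = max b (L / 2)"
  have z: "\<phi> x = 0" if "x \<notin> {a'..b'}" for x
    using that ab(3)[of x] by (auto simp: a'_def b'_def min_le_iff_disj le_max_iff_disj)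
  have "deriv \<phi> x = 0" if "x \<notin> {a'..b'}" for x
  proof -
    have "((\<lambda>x. 0) has_real_derivative 0) (at x)" by simp
    then have "(\<phi> has_real_derivative 0) (at x)"
      using that z by (rule_tac has_field_derivative_transform_within_open[where S = "- {a'..b'}"]) auto
    then show ?thesis by (rule DERIV_imp_deriv)
  qed
  then show thesis
    using ab(1,2) assms(2) z by (intro that[of a' b']) (auto simp: a'_def b'_def)
qed

lemma deriv_in_test_functions:
  assumes "\<phi> \<in> test_functions L" "0 < L"
  shows "deriv \<phi> \<in> test_functions L"
proof -
  have "(deriv ^^ m) (deriv \<phi>) differentiable_on UNIV" for m
  proof -
    have "(deriv ^^ Suc m) \<phi> differentiable_on UNIV"
      using assms(1) unfolding test_functions_def by blast
    then show ?thesis by (simp only: funpow_Suc_right o_apply)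
  qed
  moreover obtain a b where "0 < a" "b < L" "\<And>x. x \<notin> {a..b} \<Longrightarrow> deriv \<phi> x = 0"
    using test_functions_support[OF assms] by metis
  ultimately show ?thesis unfolding test_functions_def by blast
qed

lemma test_functions_continuous:
  assumes "\<phi> \<in> test_functions L"
  shows "continuous_on S \<phi>"
  using test_functions_has_deriv[OF assms] DERIV_isCont
  by (intro continuous_at_imp_continuous_on) blast

lemma test_functions_bounded:
  assumes "\<phi> \<in> test_functions L" "0 < L"
  obtains B where "\<And>x. \<bar>\<phi> x\<bar> \<le> B"
proof -
  obtain a b where ab: "\<And>x. x \<notin> {a..b} \<Longrightarrow> \<phi> x = 0"
    using test_functions_support[OF assms] by metis
  have "compact (\<phi> ` {a..b})"
    using test_functions_continuous[OF assms(1)] by (intro compact_continuous_image) auto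
  then obtain B where "\<And>y. y \<in> \<phi> ` {a..b} \<Longrightarrow> \<bar>y\<bar> \<le> B"
    using compact_imp_bounded bounded_real by metis
  then have "\<bar>\<phi> x\<bar> \<le> max 0 B" for x
    using ab[of x] by (cases "x \<in> {a..b}") (auto simp: le_max_iff_disj)
  then show thesis by (rule that)
qed

lemma finite_measure_Omega: "finite_measure (Omega L)"
  by (rule finite_measureI, cases "0 \<le> L") (auto simp: space_restrict_space emeasure_restrict_space)

lemma integrable_Omega_bounded:
  fixes f :: "real \<Rightarrow> real"
  assumes "f \<in> borel_measurable (Omega L)" "\<And>x. 0 < x \<Longrightarrow> x < L \<Longrightarrow> \<bar>f x\<bar> \<le> B"
  shows "integrable (Omega L) f"
  using assms by (intro finite_measure.integrable_const_bound[OF finite_measure_Omega, where B = B]) auto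

lemma test_functions_measurable:
  assumes "\<phi> \<in> test_functions L"
  shows "\<phi> \<in> borel_measurable (Omega L)"
  using test_functions_continuous[OF assms] by (intro continuous_imp_measurable_on_sets_lebesgue) auto

lemma test_functions_L2:
  assumes "\<phi> \<in> test_functions L" "0 < L"
  shows "\<phi> \<in> L2 L"
proof -
  obtain B where B: "\<And>x. \<bar>\<phi> x\<bar> \<le> B" using test_functions_bounded[OF assms] by blast
  have [measurable]: "\<phi> \<in> borel_measurable (Omega L)"
    using assms by (simp add: test_functions_measurable)
  have "integrable (Omega L) (\<lambda>x. (\<phi> x)\<^sup>2)"
  proof (rule integrable_Omega_bounded)
    show "\<bar>(\<phi> x)\<^sup>2\<bar> \<le> B\<^sup>2" for x
      using power_mono[OF B[of x], of 2] by simp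
  qed measurable
  then show ?thesis by (simp add: L2_def)
qed

section \<open>Weak derivatives and density of the test functions\<close>

lemma sobolev_1:
  assumes "u \<in> sobolev L 1"
  shows "u \<in> L2 L" "weak_deriv L u \<in> L2 L" "has_weak_deriv L u (weak_deriv L u)"
proof -
  have 1: "\<forall>i\<le>1. (weak_deriv L ^^ i) u \<in> L2 L"
    and 2: "\<forall>i<1. has_weak_deriv L ((weak_deriv L ^^ i) u) ((weak_deriv L ^^ Suc i) u)"
    using assms by (auto simp: sobolev_def)
  show "u \<in> L2 L" "weak_deriv L u \<in> L2 L" "has_weak_deriv L u (weak_deriv L u)"
    using 1[rule_format, of 0] 1[rule_format, of 1] 2[rule_format, of 0] by simp_all
qed

lemma sobolev_2:
  assumes "u \<in> sobolev L 2"
  shows "weak_deriv L (weak_deriv L u) \<in> L2 L"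
    "has_weak_deriv L (weak_deriv L u) (weak_deriv L (weak_deriv L u))"
proof -
  have 1: "\<forall>i\<le>2. (weak_deriv L ^^ i) u \<in> L2 L"
    and 2: "\<forall>i<2. has_weak_deriv L ((weak_deriv L ^^ i) u) ((weak_deriv L ^^ Suc i) u)"
    using assms by (auto simp: sobolev_def)
  show "weak_deriv L (weak_deriv L u) \<in> L2 L"
    "has_weak_deriv L (weak_deriv L u) (weak_deriv L (weak_deriv L u))"
    using 1[rule_format, of 2] 2[rule_format, of 1] by (simp_all add: numeral_2_eq_2)
qed

lemma sobolev_norm_2:
  "(sobolev_norm L 2 u)\<^sup>2 = (L2_norm L u)\<^sup>2 + (L2_norm L (weak_deriv L u))\<^sup>2
     + (L2_norm L (weak_deriv L (weak_deriv L u)))\<^sup>2"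
  unfolding sobolev_norm_def by (simp add: numeral_2_eq_2)

lemma H10_D:
  assumes "u \<in> H10 L"
  shows "u \<in> L2 L" "weak_deriv L u \<in> L2 L" "has_weak_deriv L u (weak_deriv L u)"
  using assms sobolev_1[of u L] by (auto simp: H10_def)

text \<open>The left-hand side is continuous in the norm of H^1 by Cauchy-Schwarz, and the test
  functions are dense in \<open>H10\<close>. This is what permits testing the scheme, stated for
  smooth functions, with its own solution.\<close>

lemma H10_weak_equation_extends:
  assumes "0 < L" and a: "a \<in> L2 L" and b: "b \<in> L2 L" and u: "u \<in> H10 L"
    and eq: "\<And>\<phi>. \<phi> \<in> test_functions L \<Longrightarrow> regular_distr L a \<phi> + regular_distr L b (deriv \<phi>) = 0"
  shows "regular_distr L a u + regular_distr L b (weak_deriv L u) = 0"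
proof -
  let ?v = "weak_deriv L u" and ?E = "regular_distr L a u + regular_distr L b (weak_deriv L u)"
  have uv: "u \<in> L2 L" "?v \<in> L2 L" using H10_D[OF u] by auto
  obtain \<phi> where \<phi>: "\<And>m. \<phi> m \<in> test_functions L"
    "(\<lambda>m::nat. L2_norm L (\<lambda>x. u x - \<phi> m x)) \<longlonglongrightarrow> 0"
    "(\<lambda>m. L2_norm L (\<lambda>x. ?v x - deriv (\<phi> m) x)) \<longlonglongrightarrow> 0"
    using u unfolding H10_def by blast
  have \<phi>_L2: "\<phi> m \<in> L2 L" "deriv (\<phi> m) \<in> L2 L" for m
    using \<phi>(1)[of m] \<open>0 < L\<close> by (auto intro: test_functions_L2 deriv_in_test_functions)
  have "\<bar>?E\<bar> \<le> L2_norm L (\<lambda>x. u x - \<phi> m x) * L2_norm L a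
      + L2_norm L (\<lambda>x. ?v x - deriv (\<phi> m) x) * L2_norm L b" for m
  proof -
    have "?E = (regular_distr L u a - regular_distr L (\<phi> m) a)
        + (regular_distr L ?v b - regular_distr L (deriv (\<phi> m)) b)"
      using eq[OF \<phi>(1), of m] by (simp add: regular_distr_commute)
    also have "\<dots> = regular_distr L (\<lambda>x. u x - \<phi> m x) a + regular_distr L (\<lambda>x. ?v x - deriv (\<phi> m) x) b"
      using uv \<phi>_L2 a b by (simp add: regular_distr_diff)
    finally show ?thesis
      using abs_regular_distr_le[OF L2_diff[OF uv(1) \<phi>_L2(1)] a, of m]
        abs_regular_distr_le[OF L2_diff[OF uv(2) \<phi>_L2(2)] b, of m] by linarith
  qed
  moreover have "(\<lambda>m. L2_norm L (\<lambda>x. u x - \<phi> m x) * L2_norm L a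
      + L2_norm L (\<lambda>x. ?v x - deriv (\<phi> m) x) * L2_norm L b) \<longlonglongrightarrow> 0 * L2_norm L a + 0 * L2_norm L b"
    by (intro tendsto_intros \<phi>)
  ultimately have "\<bar>?E\<bar> \<le> 0"
    by (intro LIMSEQ_le_const[where X = "\<lambda>m. L2_norm L (\<lambda>x. u x - \<phi> m x) * L2_norm L a
      + L2_norm L (\<lambda>x. ?v x - deriv (\<phi> m) x) * L2_norm L b"]) auto
  then show ?thesis by simp
qed

section \<open>Multiplication by a coefficient that is only differentiable\<close>

lemma borel_measurable_deriv_Omega:
  fixes G :: "real \<Rightarrow> real"
  assumes "\<And>x. 0 < x \<Longrightarrow> x < L \<Longrightarrow> G differentiable (at x)"
  shows "deriv G \<in> borel_measurable (Omega L)"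
proof (rule borel_measurable_LIMSEQ_real)
  \<comment> \<open>The derivative is a pointwise limit of continuous difference quotients. The
    increment is proportional to L - x, which keeps x + \<open>?h n x\<close> inside the
    interval.\<close>
  let ?h = "\<lambda>n x. (L - x) / real (n + 2)"
  have G: "(G has_real_derivative deriv G x) (at x)" if "x \<in> {0<..<L}" for x
    using assms[of x] that DERIV_deriv_iff_real_differentiable by auto
  have cont: "continuous_on {0<..<L} G"
    using G DERIV_isCont by (intro continuous_at_imp_continuous_on) blast
  have h: "0 < ?h n x" "x + ?h n x < L" if "x \<in> {0<..<L}" for n x
  proof -
    show "0 < ?h n x" using that by simp
    have "(L - x) / real (n + 2) < (L - x) / 1"
      using that by (intro divide_strict_left_mono) auto
    then show "x + ?h n x < L" by simp
  qed
  show "(\<lambda>x. (G (x + ?h n x) - G x) / ?h n x) \<in> borel_measurable (Omega L)" for n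
  proof (rule continuous_imp_measurable_on_sets_lebesgue)
    have "(\<lambda>x. x + ?h n x) ` {0<..<L} \<subseteq> {0<..<L}"
    proof (rule image_subsetI)
      fix x assume "x \<in> {0<..<L}"
      with h[OF this, of n] show "x + ?h n x \<in> {0<..<L}" by simp
    qed
    moreover have "\<forall>x\<in>{0<..<L}. ?h n x \<noteq> 0" "\<forall>x\<in>{0<..<L}. real (n + 2) \<noteq> 0"
      by auto
    ultimately show "continuous_on {0<..<L} (\<lambda>x. (G (x + ?h n x) - G x) / ?h n x)"
      by (intro continuous_on_divide continuous_on_diff continuous_on_add continuous_on_id
          continuous_on_const cont continuous_on_compose2[OF cont])
  qed simp
  fix x assume "x \<in> space (Omega L)"
  then have x: "x \<in> {0<..<L}" by simp
  have "(\<lambda>n. (L - x) * inverse (real (n + 2))) \<longlonglongrightarrow> (L - x) * 0"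
    using LIMSEQ_ignore_initial_segment[OF lim_inverse_n, of 2] by (intro tendsto_mult tendsto_const) simp
  then have "(\<lambda>n. ?h n x) \<longlonglongrightarrow> 0" by (simp add: divide_inverse)
  then have "filterlim (\<lambda>n. ?h n x) (at 0) sequentially"
    using less_imp_neq[OF h(1)[OF x]] by (intro filterlim_atI always_eventually) metis+
  from filterlim_compose[OF G[OF x, unfolded DERIV_def] this]
  show "(\<lambda>n. (G (x + ?h n x) - G x) / ?h n x) \<longlonglongrightarrow> deriv G x" .
qed

text \<open>The integrand is the derivative of G \<phi> \<psi>, which vanishes near both ends. As
  the derivative of G is merely bounded, the fundamental theorem is used for the gauge integral;
  boundedness and measurability then identify it with the Lebesgue integral.\<close>

lemma integral_test_product_deriv:
  fixes G :: "real \<Rightarrow> real"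
  assumes "0 < L" and \<phi>: "\<phi> \<in> test_functions L" and \<psi>: "\<psi> \<in> test_functions L"
    and G: "\<And>x. 0 < x \<Longrightarrow> x < L \<Longrightarrow> G differentiable (at x)"
    and bounds: "\<And>x. 0 < x \<Longrightarrow> x < L \<Longrightarrow> \<bar>G x\<bar> \<le> B" "\<And>x. 0 < x \<Longrightarrow> x < L \<Longrightarrow> \<bar>deriv G x\<bar> \<le> B"
  shows "(\<integral>x. (G x * deriv \<phi> x + deriv G x * \<phi> x) * \<psi> x + (G x * \<phi> x) * deriv \<psi> x \<partial>Omega L) = 0"
proof -
  let ?d = "\<lambda>x. (G x * deriv \<phi> x + deriv G x * \<phi> x) * \<psi> x + (G x * \<phi> x) * deriv \<psi> x"
  obtain a b where ab: "0 < a" "a \<le> b" "b < L"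
      "\<And>x. x \<notin> {a..b} \<Longrightarrow> \<phi> x = 0" "\<And>x. x \<notin> {a..b} \<Longrightarrow> deriv \<phi> x = 0"
    using test_functions_support[OF \<phi> \<open>0 < L\<close>] by metis
  have G': "(G has_real_derivative deriv G x) (at x)" if "0 < x" "x < L" for x
    using G[OF that] DERIV_deriv_iff_real_differentiable by auto
  \<comment> \<open>Points strictly between the support of \<phi> and the ends of (0, L): \<phi>
    vanishes at both, and G is differentiable on all of [a', b'].\<close>
  define a' b' where "a' = a / 2" and "b' = (b + L) / 2"
  have a'b': "0 < a'" "a' < a" "b < b'" "b' < L" "a' \<le> b'"
    using ab by (auto simp: a'_def b'_def)
  have "(?d has_integral (G b' * \<phi> b' * \<psi> b' - G a' * \<phi> a' * \<psi> a')) {a'..b'}"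
  proof (rule fundamental_theorem_of_calculus[where f = "\<lambda>x. G x * \<phi> x * \<psi> x"])
    fix x assume "x \<in> {a'..b'}"
    then have "((\<lambda>x. G x * \<phi> x * \<psi> x) has_real_derivative
        (deriv G x * \<phi> x + deriv \<phi> x * G x) * \<psi> x + deriv \<psi> x * (G x * \<phi> x)) (at x)"
      using a'b' by (intro DERIV_mult G' test_functions_has_deriv[OF \<phi>] test_functions_has_deriv[OF \<psi>]) auto
    then have "((\<lambda>x. G x * \<phi> x * \<psi> x) has_real_derivative ?d x) (at x)"
      by (simp add: algebra_simps)
    then show "((\<lambda>x. G x * \<phi> x * \<psi> x) has_vector_derivative ?d x) (at x within {a'..b'})"
      by (simp add: has_field_derivative_at_within flip: has_real_derivative_iff_has_vector_derivative)
  qed (use a'b' in simp)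
  moreover have "\<phi> a' = 0" "\<phi> b' = 0" using ab(4) a'b' by auto
  ultimately have "(?d has_integral 0) {a'..b'}" by simp
  then have int: "(?d has_integral 0) {0<..<L}"
  proof (rule has_integral_on_superset)
    show "{a'..b'} \<subseteq> {0<..<L}" using a'b' by auto
    show "?d x = 0" if "x \<notin> {a'..b'}" for x
      using ab(4,5)[of x] a'b' that by auto
  qed
  have G_cont: "continuous_on {0<..<L} G"
    using G by (intro continuous_at_imp_continuous_on ballI differentiable_imp_continuous_within) auto
  have [measurable]: "G \<in> borel_measurable (Omega L)"
    using G_cont by (rule continuous_imp_measurable_on_sets_lebesgue) simp
  have [measurable]: "deriv G \<in> borel_measurable (Omega L)"
    using G by (rule borel_measurable_deriv_Omega)
  have d: "deriv \<phi> \<in> test_functions L" "deriv \<psi> \<in> test_functions L"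
    using \<phi> \<psi> \<open>0 < L\<close> by (auto intro: deriv_in_test_functions)
  have "(\<lambda>x. G x * deriv \<phi> x + deriv G x * \<phi> x) \<in> L2 L" "(\<lambda>x. G x * \<phi> x) \<in> L2 L"
    using bounds test_functions_L2[OF \<phi> \<open>0 < L\<close>] test_functions_L2[OF d(1) \<open>0 < L\<close>]
    by (auto intro!: L2_add L2_bounded_mult[where B = B])
  then have "integrable (Omega L) ?d"
    using \<psi> d \<open>0 < L\<close>
    by (intro Bochner_Integration.integrable_add integrable_L2_mult) (auto intro: test_functions_L2)
  then have "(\<integral>x. ?d x \<partial>Omega L) = integral {0<..<L} ?d"
    by (intro lebesgue_integral_eq_integral) auto
  also have "\<dots> = 0" using int by (rule integral_unique)
  finally show ?thesis .
qed

text \<open>The product rule for G u in weak form. G \<phi> need not be a test function, so G is put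
  on the side of \<phi>; the identity holds against every test function \<psi>, extends from \<psi>
  to u by density, and is regrouped.\<close>

lemma H10_mult_parts:
  fixes G :: "real \<Rightarrow> real"
  assumes "0 < L" and \<phi>: "\<phi> \<in> test_functions L" and u: "u \<in> H10 L"
    and G: "\<And>x. 0 < x \<Longrightarrow> x < L \<Longrightarrow> G differentiable (at x)"
    and bounds: "\<And>x. 0 < x \<Longrightarrow> x < L \<Longrightarrow> \<bar>G x\<bar> \<le> B" "\<And>x. 0 < x \<Longrightarrow> x < L \<Longrightarrow> \<bar>deriv G x\<bar> \<le> B"
  shows "regular_distr L (\<lambda>x. G x * u x) (deriv \<phi>)
    = - regular_distr L (\<lambda>x. deriv G x * u x + G x * weak_deriv L u x) \<phi>"
proof -
  have G_cont: "continuous_on {0<..<L} G"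
    using G by (intro continuous_at_imp_continuous_on ballI differentiable_imp_continuous_within) auto
  have [measurable]: "G \<in> borel_measurable (Omega L)"
    using G_cont by (rule continuous_imp_measurable_on_sets_lebesgue) simp
  have [measurable]: "deriv G \<in> borel_measurable (Omega L)"
    using G by (rule borel_measurable_deriv_Omega)
  have d: "deriv \<phi> \<in> test_functions L" using \<phi> \<open>0 < L\<close> by (rule deriv_in_test_functions)
  have \<phi>L2: "\<phi> \<in> L2 L" "deriv \<phi> \<in> L2 L" using \<phi> d \<open>0 < L\<close> by (auto intro: test_functions_L2)
  have GL2: "(\<lambda>x. G x * v x) \<in> L2 L" "(\<lambda>x. deriv G x * v x) \<in> L2 L" if "v \<in> L2 L" for v
    using that bounds by (auto intro!: L2_bounded_mult[where B = B])
  have u': "u \<in> L2 L" "weak_deriv L u \<in> L2 L" using H10_D[OF u] by auto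
  let ?a = "\<lambda>x. G x * deriv \<phi> x + deriv G x * \<phi> x" and ?b = "\<lambda>x. G x * \<phi> x"
  have "regular_distr L ?a u + regular_distr L ?b (weak_deriv L u) = 0"
  proof (rule H10_weak_equation_extends[OF \<open>0 < L\<close> _ _ u])
    fix \<psi> assume \<psi>: "\<psi> \<in> test_functions L"
    then have "deriv \<psi> \<in> test_functions L" using \<open>0 < L\<close> by (rule deriv_in_test_functions)
    then have "\<psi> \<in> L2 L" "deriv \<psi> \<in> L2 L" using \<psi> \<open>0 < L\<close> by (auto intro: test_functions_L2)
    then have "regular_distr L ?a \<psi> + regular_distr L ?b (deriv \<psi>) =
        (\<integral>x. (G x * deriv \<phi> x + deriv G x * \<phi> x) * \<psi> x + (G x * \<phi> x) * deriv \<psi> x \<partial>Omega L)"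
      unfolding regular_distr_def
      by (intro Bochner_Integration.integral_add[symmetric] integrable_L2_mult L2_add GL2 \<phi>L2)
    also have "\<dots> = 0" using \<open>0 < L\<close> \<phi> \<psi> G bounds by (rule integral_test_product_deriv)
    finally show "regular_distr L ?a \<psi> + regular_distr L ?b (deriv \<psi>) = 0" .
  qed (intro L2_add GL2 \<phi>L2)+
  moreover have "regular_distr L ?a u = regular_distr L (\<lambda>x. G x * u x) (deriv \<phi>)
      + regular_distr L (\<lambda>x. deriv G x * u x) \<phi>"
  proof -
    have "regular_distr L ?a u = (\<integral>x. (G x * u x) * deriv \<phi> x + (deriv G x * u x) * \<phi> x \<partial>Omega L)"
      unfolding regular_distr_def by (intro Bochner_Integration.integral_cong) (auto simp: algebra_simps)
    also have "\<dots> = regular_distr L (\<lambda>x. G x * u x) (deriv \<phi>) + regular_distr L (\<lambda>x. deriv G x * u x) \<phi>"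
      unfolding regular_distr_def
      by (intro Bochner_Integration.integral_add integrable_L2_mult GL2 u' \<phi>L2)
    finally show ?thesis .
  qed
  moreover have "regular_distr L ?b (weak_deriv L u) = regular_distr L (\<lambda>x. G x * weak_deriv L u x) \<phi>"
    by (simp add: regular_distr_def mult_ac)
  ultimately show ?thesis
    using regular_distr_add[OF GL2(2)[OF u'(1)] GL2(1)[OF u'(2)] \<phi>L2(1)] by simp
qed

section \<open>Pointwise energy inequality\<close>

text \<open>With S for (F J)_x, the coefficient of dJ^2 is C - 1 from the S^2 produced by w, and C
  from - 2 C S J. Together they stay below the 2 C that the test function 2 C J provides, which
  explains this multiple. The J^2 terms add up to C^2 + 2 C - 1 and the f^2 terms to 1 + C.\<close>

lemma energy_pointwise:
  fixes F Fx J dJ w dw f C :: real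
  assumes C: "1 + F\<^sup>2 + Fx\<^sup>2 \<le> C"
  shows "w\<^sup>2 / 2 \<le> (C\<^sup>2 + 2 * C) * J\<^sup>2 + (1 + C) * f\<^sup>2
    + ((w + (Fx * J + F * dJ) - f) * (w + 2 * C * J) + dJ * (dw + 2 * C * dJ))
    - dJ * dw - 2 * C * (w * J)"
proof -
  define S where "S = Fx * J + F * dJ"
  have "0 \<le> C" using C zero_le_power2[of F] zero_le_power2[of Fx] by linarith
  \<comment> \<open>Young's inequality that spends only half of w^2, written as a sum of two
    squares.\<close>
  have h1: "- ((S - f) * w) \<le> w\<^sup>2 / 2 + S\<^sup>2 + f\<^sup>2"
    using zero_le_power2[of "w + (S - f)"] zero_le_power2[of "S + f"]
    by (simp add: power2_eq_square algebra_simps)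
  have "S\<^sup>2 \<le> (Fx\<^sup>2 + F\<^sup>2) * (J\<^sup>2 + dJ\<^sup>2)"
    using zero_le_power2[of "Fx * dJ - F * J"] unfolding S_def
    by (simp add: power2_eq_square algebra_simps)
  also have "\<dots> \<le> (C - 1) * (J\<^sup>2 + dJ\<^sup>2)"
    using C by (intro mult_right_mono) auto
  finally have h2: "S\<^sup>2 \<le> (C - 1) * (J\<^sup>2 + dJ\<^sup>2)" .
  have "- 2 * (S * J) \<le> (1 + F\<^sup>2 + Fx\<^sup>2) * J\<^sup>2 + dJ\<^sup>2"
    using zero_le_power2[of "J + Fx * J"] zero_le_power2[of "dJ + F * J"] unfolding S_def
    by (simp add: power2_eq_square algebra_simps)
  also have "\<dots> \<le> C * J\<^sup>2 + dJ\<^sup>2"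
    using C by (intro add_right_mono mult_right_mono) auto
  finally have "C * (- 2 * (S * J)) \<le> C * (C * J\<^sup>2 + dJ\<^sup>2)"
    using \<open>0 \<le> C\<close> by (rule mult_left_mono)
  then have h3: "- (2 * (C * (S * J))) \<le> C\<^sup>2 * J\<^sup>2 + C * dJ\<^sup>2"
    by (simp add: power2_eq_square algebra_simps)
  have h4: "C * (2 * f * J) \<le> C * (f\<^sup>2 + J\<^sup>2)"
    using \<open>0 \<le> C\<close> sum_squares_bound[of f J] by (intro mult_left_mono) auto
  have split: "(w + S - f) * (w + 2 * C * J) + dJ * (dw + 2 * C * dJ) - dJ * dw - 2 * C * (w * J)
      = w\<^sup>2 + (S - f) * w + 2 * (C * (S * J)) - C * (2 * f * J) + 2 * (C * dJ\<^sup>2)"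
    by (simp add: power2_eq_square algebra_simps)
  have distr: "(C\<^sup>2 + 2 * C) * J\<^sup>2 = C\<^sup>2 * J\<^sup>2 + 2 * (C * J\<^sup>2)" "(1 + C) * f\<^sup>2 = f\<^sup>2 + C * f\<^sup>2"
    "(C - 1) * (J\<^sup>2 + dJ\<^sup>2) = C * J\<^sup>2 + C * dJ\<^sup>2 - J\<^sup>2 - dJ\<^sup>2" "C * (f\<^sup>2 + J\<^sup>2) = C * f\<^sup>2 + C * J\<^sup>2"
    by (simp_all add: algebra_simps)
  \<comment> \<open>Replacing all products by variables turns the combination of the bounds into a
    linear problem.\<close>
  have linear: "X / 2 \<le> P + Q + (R1 + R2) - R3 - R4"
    if "R1 + R2 - R3 - R4 = X + Y + 2 * Z - V + 2 * D" "P = PJ + 2 * CJ" "Q = f2 + Cf"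
      "B = CJ + D - J2 - D2" "E = Cf + CJ" "- Y \<le> X / 2 + S2 + f2" "S2 \<le> B"
      "- (2 * Z) \<le> PJ + D" "V \<le> E" "0 \<le> J2" "0 \<le> D2"
    for X Y Z V D P Q B E R1 R2 R3 R4 PJ CJ Cf J2 D2 S2 f2 :: real
    using that by linarith
  show ?thesis
    unfolding S_def[symmetric]
    by (rule linear[OF split distr h1 h2 h3 h4 zero_le_power2 zero_le_power2])
qed

text \<open>Cauchy-Schwarz for the vectors (1, -Fx, -F) and (z, a, b); the three squares used are
  the cross terms of Lagrange's identity. The 1 in the hypothesis on C pays for z, which will be the
  second derivative of U^0.\<close>

lemma source_pointwise:
  fixes F Fx a b z g \<beta> C :: real
  assumes C: "1 + F\<^sup>2 + Fx\<^sup>2 \<le> C"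
  shows "(g + \<beta> * (z - (Fx * a + F * b)))\<^sup>2 \<le> 2 * g\<^sup>2 + 2 * \<beta>\<^sup>2 * C * (a\<^sup>2 + b\<^sup>2 + z\<^sup>2)"
proof -
  have "(z - (Fx * a + F * b))\<^sup>2 \<le> (1 + F\<^sup>2 + Fx\<^sup>2) * (a\<^sup>2 + b\<^sup>2 + z\<^sup>2)"
    using zero_le_power2[of "z * Fx + a"] zero_le_power2[of "z * F + b"] zero_le_power2[of "Fx * b - F * a"]
    by (simp add: power2_eq_square algebra_simps)
  also have "\<dots> \<le> C * (a\<^sup>2 + b\<^sup>2 + z\<^sup>2)"
    using C by (intro mult_right_mono) auto
  finally have "2 * \<beta>\<^sup>2 * (z - (Fx * a + F * b))\<^sup>2 \<le> 2 * \<beta>\<^sup>2 * (C * (a\<^sup>2 + b\<^sup>2 + z\<^sup>2))"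
    by (intro mult_left_mono) auto
  moreover have "(g + \<beta> * y)\<^sup>2 \<le> 2 * g\<^sup>2 + 2 * \<beta>\<^sup>2 * y\<^sup>2" for y
    using zero_le_power2[of "g - \<beta> * y"] by (simp add: power2_eq_square algebra_simps)
  ultimately show ?thesis
    by (smt (verit) mult.assoc)
qed

section \<open>Summation in time and absorption of the implicit term\<close>

lemma weighted_sum_square_le:
  fixes a :: "nat \<Rightarrow> real"
  assumes "0 < \<alpha>" "0 < k"
  shows "(\<Sum>j=1..n. quad_weight \<alpha> k (n - j) * a j)\<^sup>2
    \<le> (real n * k) powr \<alpha> / Gamma (\<alpha> + 1) * (\<Sum>j=1..n. quad_weight \<alpha> k (n - j) * (a j)\<^sup>2)"
proof -
  let ?q = "\<lambda>j. quad_weight \<alpha> k (n - j)"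
  have q: "0 \<le> ?q j" for j using assms by (simp add: quad_weight_nonneg)
  have "(\<Sum>j=1..n. ?q j * a j) = (\<Sum>j=1..n. sqrt (?q j) * (sqrt (?q j) * a j))"
    using q by (intro sum.cong refl) (simp flip: mult.assoc)
  then have "(\<Sum>j=1..n. ?q j * a j)\<^sup>2 \<le> (\<Sum>j=1..n. (sqrt (?q j))\<^sup>2) * (\<Sum>j=1..n. (sqrt (?q j) * a j)\<^sup>2)"
    by (simp only: Cauchy_Schwarz_ineq_sum)
  also have "(\<Sum>j=1..n. (sqrt (?q j))\<^sup>2) = (\<Sum>j=1..n. ?q j)"
    using q by (intro sum.cong refl) simp
  also have "\<dots> = (real n * k) powr \<alpha> / Gamma (\<alpha> + 1)"
    unfolding sum_diff_index using assms by (rule quad_weight_sum)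
  also have "(\<Sum>j=1..n. (sqrt (?q j) * a j)\<^sup>2) = (\<Sum>j=1..n. ?q j * (a j)\<^sup>2)"
    using q by (intro sum.cong refl) (simp add: power_mult_distrib)
  finally show ?thesis .
qed

text \<open>Summation in time commutes with the discrete fractional integral, as convolutions do. A
  bound on sums of Y thereby becomes an inequality for the partial sums alone, the form that
  Gronwall requires.\<close>

lemma sum_convolution_partial_sums:
  fixes b Y :: "nat \<Rightarrow> real"
  shows "(\<Sum>n=1..m. \<Sum>j=1..n. b (n - j) * Y j) = (\<Sum>j=1..m. b (m - j) * (\<Sum>i=1..j. Y i))"
proof (induction m)
  case (Suc m)
  have shift: "(\<Sum>j=1..Suc m. b (Suc m - j) * h j) = b m * h 1 + (\<Sum>j=1..m. b (m - j) * h (Suc j))"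
    for h :: "nat \<Rightarrow> real"
  proof -
    have "(\<Sum>j=1..Suc m. b (Suc m - j) * h j) = (\<Sum>j=0..m. b (m - j) * h (Suc j))"
      by (rule sum.reindex_bij_witness[of _ Suc "\<lambda>j. j - 1"]) auto
    then show ?thesis by (simp add: sum.atLeast_Suc_atMost)
  qed
  have "(\<Sum>n=1..Suc m. \<Sum>j=1..n. b (n - j) * Y j)
      = (\<Sum>j=1..m. b (m - j) * (\<Sum>i=1..j. Y i)) + (\<Sum>j=1..Suc m. b (Suc m - j) * Y j)"
    using Suc by simp
  also have "(\<Sum>j=1..Suc m. b (Suc m - j) * Y j) = b m * Y 1 + (\<Sum>j=1..m. b (m - j) * Y (Suc j))"
    by (rule shift)
  also have "(\<Sum>j=1..m. b (m - j) * (\<Sum>i=1..j. Y i)) + (b m * Y 1 + (\<Sum>j=1..m. b (m - j) * Y (Suc j)))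
      = b m * (\<Sum>i=1..1. Y i) + (\<Sum>j=1..m. b (m - j) * (\<Sum>i=1..Suc j. Y i))"
    by (simp add: distrib_left sum.distrib)
  also have "\<dots> = (\<Sum>j=1..Suc m. b (Suc m - j) * (\<Sum>i=1..j. Y i))"
    by (rule shift[symmetric])
  finally show ?case .
qed simp

lemma absorbed_fractional_gronwall:
  fixes Y a :: "nat \<Rightarrow> real"
  assumes \<alpha>: "1/2 < \<alpha>" "\<alpha> \<le> 1" and k: "0 < k" and M: "0 \<le> M"
    and Y: "\<And>j. 0 \<le> Y j" and a: "\<And>j. 0 \<le> a j"
    and small: "M * ((real n * k) powr \<alpha> / Gamma (\<alpha> + 1)) * quad_weight \<alpha> k 0 \<le> 1/2"
    and bound: "\<And>m. m \<in> {1..n} \<Longrightarrow> (\<Sum>j=1..m. Y j) \<le> (\<Sum>j=1..m. a j)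
      + M * (\<Sum>i=1..m. (real i * k) powr \<alpha> / Gamma (\<alpha> + 1) * (\<Sum>j=1..i. quad_weight \<alpha> k (i - j) * Y j))"
    and "1 \<le> n"
  shows "(\<Sum>j=1..n. Y j) \<le> 2 * (\<Sum>j=1..n. a j)
      * mittag_leffler \<alpha> (2 * M * (real n * k) powr (2 * \<alpha>) / Gamma (\<alpha> + 1))"
proof -
  define W where "W = (real n * k) powr \<alpha> / Gamma (\<alpha> + 1)"
  define y where "y m = (\<Sum>j=1..m. Y j)" for m
  have \<Gamma>: "0 < Gamma (\<alpha> + 1)" using \<alpha> by (intro Gamma_real_pos) auto
  have W: "0 \<le> W" using \<Gamma> by (simp add: W_def)
  have q: "0 \<le> quad_weight \<alpha> k j" for j using \<alpha> by (intro quad_weight_nonneg) auto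
  have y: "0 \<le> y m" for m using Y by (simp add: y_def sum_nonneg)
  have "y m \<le> 2 * (\<Sum>j=1..n. a j) + (2 * M * W) * (\<Sum>j=1..<m. quad_weight \<alpha> k (m - j) * y j)"
    if m: "m \<in> {1..n}" for m
  proof -
    let ?s = "\<Sum>j=1..<m. quad_weight \<alpha> k (m - j) * y j"
    have "(\<Sum>j=1..m. a j) \<le> (\<Sum>j=1..n. a j)"
      using m a by (intro sum_mono2) auto
    moreover have "(\<Sum>i=1..m. (real i * k) powr \<alpha> / Gamma (\<alpha> + 1) * (\<Sum>j=1..i. quad_weight \<alpha> k (i - j) * Y j))
        \<le> (\<Sum>i=1..m. W * (\<Sum>j=1..i. quad_weight \<alpha> k (i - j) * Y j))"
      unfolding W_def using m \<alpha> k \<Gamma> q Y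
      by (intro sum_mono mult_right_mono divide_right_mono powr_mono2 sum_nonneg mult_nonneg_nonneg) auto
    then have "M * (\<Sum>i=1..m. (real i * k) powr \<alpha> / Gamma (\<alpha> + 1) * (\<Sum>j=1..i. quad_weight \<alpha> k (i - j) * Y j))
        \<le> M * (\<Sum>i=1..m. W * (\<Sum>j=1..i. quad_weight \<alpha> k (i - j) * Y j))"
      using M by (rule mult_left_mono)
    moreover have "(\<Sum>i=1..m. W * (\<Sum>j=1..i. quad_weight \<alpha> k (i - j) * Y j))
        = W * (\<Sum>j=1..m. quad_weight \<alpha> k (m - j) * y j)"
      unfolding sum_distrib_left[symmetric] y_def by (subst sum_convolution_partial_sums) simp
    moreover have "{1..m} = insert m {1..<m}" using m by auto
    then have "(\<Sum>j=1..m. quad_weight \<alpha> k (m - j) * y j) = quad_weight \<alpha> k 0 * y m + ?s"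
      by simp
    moreover have "M * W * quad_weight \<alpha> k 0 * y m \<le> 1/2 * y m"
      using small y unfolding W_def by (rule mult_right_mono)
    ultimately show ?thesis
      using bound[OF m] unfolding y_def[symmetric] by (simp add: algebra_simps)
  qed
  from discrete_fractional_gronwall[OF \<alpha> k _ _ this, of n]
  have "y n \<le> 2 * (\<Sum>j=1..n. a j) * mittag_leffler \<alpha> (2 * M * W * (real n * k) powr \<alpha>)"
    using a M W \<open>1 \<le> n\<close> by (simp add: sum_nonneg)
  also have "2 * M * W * (real n * k) powr \<alpha> = 2 * M * (real n * k) powr (2 * \<alpha>) / Gamma (\<alpha> + 1)"
    by (simp add: W_def flip: powr_add)
  finally show ?thesis by (simp add: y_def)
qed

section \<open>The weak form of the scheme\<close>

locale implicit_scheme =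
  fixes L k \<alpha> C :: real and N :: nat
    and F :: "real \<Rightarrow> real \<Rightarrow> real" and g U :: "nat \<Rightarrow> real \<Rightarrow> real"
  assumes L: "0 < L" and k: "0 < k" and \<alpha>: "1/2 < \<alpha>" "\<alpha> \<le> 1"
    and U0: "U 0 \<in> H10 L" "U 0 \<in> sobolev L 2"
    and g: "\<And>n. n \<in> {1..N} \<Longrightarrow> g n \<in> L2 L"
    and F: "\<And>n x. n \<in> {1..N} \<Longrightarrow> 0 < x \<Longrightarrow> x < L \<Longrightarrow> (\<lambda>y. F y (real n * k)) differentiable (at x)"
      "\<And>n x. n \<in> {1..N} \<Longrightarrow> 0 < x \<Longrightarrow> x < L \<Longrightarrow>
        1 + (F x (real n * k))\<^sup>2 + (deriv (\<lambda>y. F y (real n * k)) x)\<^sup>2 \<le> C"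
    and U: "\<And>n. n \<in> {1..N} \<Longrightarrow> U n \<in> H10 L" "\<And>n. n \<in> {1..N} \<Longrightarrow> scheme_step L \<alpha> k F g U n"
begin

abbreviation D :: "(real \<Rightarrow> real) \<Rightarrow> real \<Rightarrow> real" where
  "D \<equiv> weak_deriv L"

abbreviation b :: "nat \<Rightarrow> real" where
  "b \<equiv> quad_weight \<alpha> k"

definition w :: "nat \<Rightarrow> real \<Rightarrow> real" where
  "w j x = (U j x - U (j - 1) x) / k"

text \<open>Built from \<open>D (U j)\<close> and not as \<open>D (w j)\<close>:
  \<open>weak_deriv\<close> selects a representative and is linear only almost everywhere, while the
  estimates at a fixed x use exact linearity.\<close>

definition dw :: "nat \<Rightarrow> real \<Rightarrow> real" where
  "dw j x = (D (U j) x - D (U (j - 1)) x) / k"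

definition J :: "nat \<Rightarrow> real \<Rightarrow> real" where
  "J n x = (\<Sum>j=1..n. b (n - j) * w j x)"

definition dJ :: "nat \<Rightarrow> real \<Rightarrow> real" where
  "dJ n x = (\<Sum>j=1..n. b (n - j) * dw j x)"

text \<open>(F^n u)_x expanded by the product rule, with v in the role of u_x.\<close>

definition flux :: "nat \<Rightarrow> (real \<Rightarrow> real) \<Rightarrow> (real \<Rightarrow> real) \<Rightarrow> real \<Rightarrow> real" where
  "flux n u v x = deriv (\<lambda>y. F y (real n * k)) x * u x + F x (real n * k) * v x"

text \<open>The bracket is U^0_xx - (F^n U^0)_x; its factor comes from the leftover b_(n-1) U^0 of
  the increment form, divided by k.\<close>

definition f :: "nat \<Rightarrow> real \<Rightarrow> real" where
  "f n x = g n x + b (n - 1) / k * (D (D (U 0)) x - flux n (U 0) (D (U 0)) x)"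

lemma U_H10: "j \<le> N \<Longrightarrow> U j \<in> H10 L"
  using U(1)[of j] U0(1) by (cases "j = 0") auto

lemma U_L2: "j \<le> N \<Longrightarrow> U j \<in> L2 L" "j \<le> N \<Longrightarrow> D (U j) \<in> L2 L"
  using H10_D[OF U_H10] by auto

lemma w_L2: "j \<in> {1..N} \<Longrightarrow> w j \<in> L2 L" "j \<in> {1..N} \<Longrightarrow> dw j \<in> L2 L"
  using L2_cmult[OF L2_diff[OF U_L2(1) U_L2(1)], of j "j - 1" "1 / k"]
    L2_cmult[OF L2_diff[OF U_L2(2) U_L2(2)], of j "j - 1" "1 / k"]
  by (auto simp: w_def[abs_def] dw_def[abs_def])

lemma J_L2: "n \<in> {1..N} \<Longrightarrow> J n \<in> L2 L" "n \<in> {1..N} \<Longrightarrow> dJ n \<in> L2 L"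
  unfolding J_def[abs_def] dJ_def[abs_def] by (auto intro!: L2_sum L2_cmult w_L2)

lemma F_bounds:
  assumes "n \<in> {1..N}" "0 < x" "x < L"
  shows "\<bar>F x (real n * k)\<bar> \<le> C" "\<bar>deriv (\<lambda>y. F y (real n * k)) x\<bar> \<le> C"
proof -
  have "\<bar>y\<bar> \<le> 1 + y\<^sup>2" for y :: real
    using sum_squares_bound[of "\<bar>y\<bar>" 1] zero_le_power2[of y] by (simp add: power2_eq_square; linarith)
  from this[of "F x (real n * k)"] this[of "deriv (\<lambda>y. F y (real n * k)) x"] F(2)[OF assms]
  show "\<bar>F x (real n * k)\<bar> \<le> C" "\<bar>deriv (\<lambda>y. F y (real n * k)) x\<bar> \<le> C"
    using zero_le_power2[of "F x (real n * k)"] zero_le_power2[of "deriv (\<lambda>y. F y (real n * k)) x"]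
    by linarith+
qed

lemma F_measurable:
  assumes "n \<in> {1..N}"
  shows "(\<lambda>x. F x (real n * k)) \<in> borel_measurable (Omega L)"
    "deriv (\<lambda>x. F x (real n * k)) \<in> borel_measurable (Omega L)"
proof -
  show "(\<lambda>x. F x (real n * k)) \<in> borel_measurable (Omega L)"
  proof (rule continuous_imp_measurable_on_sets_lebesgue)
    show "continuous_on {0<..<L} (\<lambda>x. F x (real n * k))"
      using F(1)[OF assms]
      by (intro continuous_at_imp_continuous_on ballI differentiable_imp_continuous_within) auto
  qed simp
  show "deriv (\<lambda>x. F x (real n * k)) \<in> borel_measurable (Omega L)"
    using F(1)[OF assms] by (rule borel_measurable_deriv_Omega)
qed

lemma F_mult_L2:
  assumes "n \<in> {1..N}" "u \<in> L2 L"
  shows "(\<lambda>x. F x (real n * k) * u x) \<in> L2 L"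
    "(\<lambda>x. deriv (\<lambda>y. F y (real n * k)) x * u x) \<in> L2 L"
  using assms F_bounds[OF assms(1)] F_measurable[OF assms(1)] by (auto intro!: L2_bounded_mult[where B = C])

lemma flux_L2:
  assumes "n \<in> {1..N}" "u \<in> L2 L" "v \<in> L2 L"
  shows "flux n u v \<in> L2 L"
  unfolding flux_def[abs_def] using assms by (intro L2_add F_mult_L2)

lemma f_L2: "n \<in> {1..N} \<Longrightarrow> f n \<in> L2 L"
  unfolding f_def[abs_def]
  using U_L2[of 0] sobolev_2(1)[OF U0(2)] by (intro L2_add g L2_cmult L2_diff flux_L2) auto

lemma flux_diff: "flux n (w j) (dw j) x = (flux n (U j) (D (U j)) x - flux n (U (j - 1)) (D (U (j - 1))) x) / k"
  by (simp add: flux_def w_def dw_def diff_divide_distrib add_divide_distrib algebra_simps)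

lemma flux_J: "flux n (J n) (dJ n) x = (\<Sum>j=1..n. b (n - j) * flux n (w j) (dw j) x)"
  by (simp add: flux_def J_def dJ_def sum_distrib_left sum.distrib distrib_left mult_ac)

text \<open>In the scheme the time derivative of the drift sits inside the distribution, pointwise
  in x. Away from two nodes it is a finite combination of the U j with coefficients depending on t
  only, so it can be pulled out, and the drift takes the form of the diffusion term.\<close>

lemma integral_drift:
  assumes n: "n \<in> {1..N}" and \<phi>: "\<phi> \<in> test_functions L"
  shows "(LINT t:{real (n - 1) * k..real n * k}|lborel.
       distr_deriv (regular_distr L
         (\<lambda>x. F x (real n * k) * frac_deriv \<alpha> (pw_const k (\<lambda>j. U j x)) t)) \<phi>)
    = (LINT t:{real (n - 1) * k..real n * k}|lborel.
       frac_deriv \<alpha> (pw_const k (\<lambda>j. distr_deriv (regular_distr L (\<lambda>x. F x (real n * k) * U j x)) \<phi>)) t)"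
  unfolding set_lebesgue_integral_def
proof (rule integral_discrete_difference[where X = "{real (n - 1) * k, real n * k}"])
  fix t assume t: "t \<notin> {real (n - 1) * k, real n * k}"
  let ?FU = "\<lambda>j x. F x (real n * k) * U j x" and ?I = "{real (n - 1) * k..real n * k}"
  let ?c = "\<lambda>j. pos_omega \<alpha> (t - real (j - 1) * k) - pos_omega \<alpha> (t - real j * k)"
  show "indicator ?I t *\<^sub>R distr_deriv (regular_distr L
         (\<lambda>x. F x (real n * k) * frac_deriv \<alpha> (pw_const k (\<lambda>j. U j x)) t)) \<phi>
      = indicator ?I t *\<^sub>R frac_deriv \<alpha> (pw_const k (\<lambda>j. distr_deriv (regular_distr L (?FU j)) \<phi>)) t"
  proof (cases "t \<in> ?I")
    case True
    then have t': "real (n - 1) * k < t" "t < real n * k" using t by auto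
    have "0 < \<alpha>" using \<alpha> by simp
    note fd = frac_deriv_pw_const[OF this k t']
    have FU: "?FU j \<in> L2 L" if "j \<in> {1..n}" for j
      using that n U_L2(1)[of j] by (intro F_mult_L2) auto
    have d: "deriv \<phi> \<in> L2 L"
      using L \<phi> by (intro test_functions_L2 deriv_in_test_functions)
    have "regular_distr L (\<lambda>x. F x (real n * k) * frac_deriv \<alpha> (pw_const k (\<lambda>j. U j x)) t) (deriv \<phi>)
        = regular_distr L (\<lambda>x. \<Sum>j=1..n. ?c j * ?FU j x) (deriv \<phi>)"
      unfolding fd by (simp only: sum_distrib_left mult_ac)
    also have "\<dots> = (\<Sum>j=1..n. ?c j * regular_distr L (?FU j) (deriv \<phi>))"
      using FU d by (rule regular_distr_sum)
    finally show ?thesis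
      unfolding fd distr_deriv_def by (simp add: sum_negf mult.commute del: of_nat_diff)
  qed simp
qed auto

text \<open>For a fixed \<phi> the scheme concerns real sequences only, so the step integral of a
  fractional derivative is known for diffusion and drift alike. Linearity in j then assembles J and
  dJ.\<close>

lemma weak_form:
  assumes n: "n \<in> {1..N}" and \<phi>: "\<phi> \<in> test_functions L"
  shows "regular_distr L (\<lambda>x. w n x + flux n (J n) (dJ n) x - f n x) \<phi> + regular_distr L (dJ n) (deriv \<phi>) = 0"
proof -
  have d: "deriv \<phi> \<in> test_functions L" using L \<phi> by (intro deriv_in_test_functions)
  have \<phi>L2: "\<phi> \<in> L2 L" "deriv \<phi> \<in> L2 L" using L \<phi> d by (auto intro: test_functions_L2)
  \<comment> \<open>The operator u -> (F^n u)_x - u_xx tested with \<phi>, where v stands for u_x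
    and one derivative stays on \<phi>.\<close>
  let ?A = "\<lambda>u v. regular_distr L (flux n u v) \<phi> + regular_distr L v (deriv \<phi>)"
  let ?q = "\<lambda>j. ?A (U j) (D (U j))"
  let ?l = "\<lambda>j. distr_deriv (distr_deriv (regular_distr L (U j))) \<phi>"
  let ?m = "\<lambda>j. distr_deriv (regular_distr L (\<lambda>x. F x (real n * k) * U j x)) \<phi>"
  have q: "?m j - ?l j = ?q j" if "j \<le> N" for j
  proof -
    have "?l j = - regular_distr L (D (U j)) (deriv \<phi>)"
      using H10_D(3)[OF U_H10[OF that]] d by (auto simp: has_weak_deriv_def distr_deriv_def)
    moreover have "?m j = regular_distr L (flux n (U j) (D (U j))) \<phi>"
      using H10_mult_parts[OF L \<phi> U_H10[OF that] F(1)[OF n] F_bounds[OF n]]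
      by (simp add: distr_deriv_def flux_def[abs_def])
    ultimately show ?thesis by simp
  qed
  have \<alpha>0: "0 < \<alpha>" using \<alpha> by simp
  have n1: "1 \<le> n" using n by simp
  note I = integral_frac_deriv_pw_const[OF \<alpha>0 k n1]
  have "regular_distr L (\<lambda>x. U n x - U (n - 1) x) \<phi>
      - ((\<Sum>j=1..n. b (n - j) * (?l j - ?l (j - 1))) + b (n - 1) * ?l 0)
      + ((\<Sum>j=1..n. b (n - j) * (?m j - ?m (j - 1))) + b (n - 1) * ?m 0)
      = k * regular_distr L (g n) \<phi>"
    using U(2)[OF n, unfolded scheme_step_def, rule_format, OF \<phi>]
    unfolding integral_drift[OF n \<phi>] I .
  moreover have "(\<Sum>j=1..n. b (n - j) * (?m j - ?m (j - 1))) - (\<Sum>j=1..n. b (n - j) * (?l j - ?l (j - 1)))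
      = (\<Sum>j=1..n. b (n - j) * (?q j - ?q (j - 1)))"
    unfolding sum_subtractf[symmetric]
  proof (intro sum.cong refl)
    fix j assume "j \<in> {1..n}"
    then have "j \<le> N" "j - 1 \<le> N" using n by auto
    from q[OF this(1)] q[OF this(2)]
    show "b (n - j) * (?m j - ?m (j - 1)) - b (n - j) * (?l j - ?l (j - 1)) = b (n - j) * (?q j - ?q (j - 1))"
      by (simp add: algebra_simps)
  qed
  moreover have "b (n - 1) * ?m 0 - b (n - 1) * ?l 0 = b (n - 1) * ?q 0"
    using q[of 0] by (simp flip: right_diff_distrib)
  ultimately have eq1: "regular_distr L (\<lambda>x. U n x - U (n - 1) x) \<phi>
      + (\<Sum>j=1..n. b (n - j) * (?q j - ?q (j - 1))) + b (n - 1) * ?q 0 = k * regular_distr L (g n) \<phi>"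
    by linarith
  have step: "?q j - ?q (j - 1) = k * ?A (w j) (dw j)" if j: "j \<in> {1..n}" for j
  proof -
    have jN: "j \<le> N" "j - 1 \<le> N" using n j by auto
    have "regular_distr L (flux n (w j) (dw j)) \<phi> = 1 / k * regular_distr L
        (\<lambda>x. flux n (U j) (D (U j)) x - flux n (U (j - 1)) (D (U (j - 1))) x) \<phi>"
      unfolding regular_distr_cmult[symmetric] by (simp add: flux_diff[abs_def])
    also have "\<dots> = 1 / k * (regular_distr L (flux n (U j) (D (U j))) \<phi>
        - regular_distr L (flux n (U (j - 1)) (D (U (j - 1)))) \<phi>)"
      using n jN \<phi>L2 by (subst regular_distr_diff) (auto intro!: flux_L2 U_L2)
    finally have 1: "regular_distr L (flux n (w j) (dw j)) \<phi> = \<dots>" .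
    have "regular_distr L (dw j) (deriv \<phi>) = 1 / k * regular_distr L
        (\<lambda>x. D (U j) x - D (U (j - 1)) x) (deriv \<phi>)"
      unfolding regular_distr_cmult[symmetric] by (simp add: dw_def[abs_def])
    also have "\<dots> = 1 / k * (regular_distr L (D (U j)) (deriv \<phi>) - regular_distr L (D (U (j - 1))) (deriv \<phi>))"
      using jN \<phi>L2 by (subst regular_distr_diff) (auto intro!: U_L2)
    finally have 2: "regular_distr L (dw j) (deriv \<phi>) = \<dots>" .
    show ?thesis unfolding 1 2 using k by (simp add: algebra_simps)
  qed
  have sum_eq: "(\<Sum>j=1..n. b (n - j) * (?q j - ?q (j - 1))) = k * ?A (J n) (dJ n)"
  proof -
    have "(\<Sum>j=1..n. b (n - j) * (?q j - ?q (j - 1))) = (\<Sum>j=1..n. b (n - j) * (k * ?A (w j) (dw j)))"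
      using step by (intro sum.cong) auto
    also have "\<dots> = k * ((\<Sum>j=1..n. b (n - j) * regular_distr L (flux n (w j) (dw j)) \<phi>)
        + (\<Sum>j=1..n. b (n - j) * regular_distr L (dw j) (deriv \<phi>)))"
      by (simp add: sum_distrib_left sum.distrib algebra_simps)
    also have "(\<Sum>j=1..n. b (n - j) * regular_distr L (flux n (w j) (dw j)) \<phi>)
        = regular_distr L (\<lambda>x. \<Sum>j=1..n. b (n - j) * flux n (w j) (dw j) x) \<phi>"
      using n \<phi>L2 by (intro regular_distr_sum[symmetric] flux_L2 w_L2) auto
    also have "(\<Sum>j=1..n. b (n - j) * regular_distr L (dw j) (deriv \<phi>)) = regular_distr L (dJ n) (deriv \<phi>)"
      unfolding dJ_def[abs_def] using n \<phi>L2 by (intro regular_distr_sum[symmetric] w_L2) auto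
    finally show ?thesis by (simp add: flux_J[abs_def])
  qed
  have w_eq: "regular_distr L (\<lambda>x. U n x - U (n - 1) x) \<phi> = k * regular_distr L (w n) \<phi>"
    unfolding regular_distr_cmult[symmetric] using k by (simp add: w_def[abs_def])
  \<comment> \<open>For U^0, which is in H^2, the second derivative is taken off \<phi>; the initial
    term thus becomes a function in L2 and part of f.\<close>
  have "regular_distr L (D (U 0)) (deriv \<phi>) = - regular_distr L (D (D (U 0))) \<phi>"
    using sobolev_2(2)[OF U0(2)] \<phi> by (auto simp: has_weak_deriv_def distr_deriv_def)
  moreover have DD: "D (D (U 0)) \<in> L2 L" "flux n (U 0) (D (U 0)) \<in> L2 L"
    using sobolev_2(1)[OF U0(2)] n U_L2[of 0] by (auto intro: flux_L2)
  ultimately have q0: "?q 0 = - regular_distr L (\<lambda>x. D (D (U 0)) x - flux n (U 0) (D (U 0)) x) \<phi>"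
    using \<phi>L2 by (simp add: regular_distr_diff)
  have f_eq: "regular_distr L (f n) \<phi> = regular_distr L (g n) \<phi> - b (n - 1) / k * ?q 0"
  proof -
    have "regular_distr L (f n) \<phi> = regular_distr L (g n) \<phi>
        + regular_distr L (\<lambda>x. b (n - 1) / k * (D (D (U 0)) x - flux n (U 0) (D (U 0)) x)) \<phi>"
      unfolding f_def[abs_def] by (intro regular_distr_add g[OF n] L2_cmult L2_diff DD \<phi>L2)
    then show ?thesis unfolding regular_distr_cmult q0 by simp
  qed
  have "k * (regular_distr L (w n) \<phi> + ?A (J n) (dJ n) - regular_distr L (f n) \<phi>) = 0"
    using eq1 unfolding w_eq sum_eq f_eq using k by (simp add: algebra_simps)
  then have "regular_distr L (w n) \<phi> + ?A (J n) (dJ n) - regular_distr L (f n) \<phi> = 0"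
    using k by simp
  moreover have "regular_distr L (\<lambda>x. w n x + flux n (J n) (dJ n) x - f n x) \<phi>
      = regular_distr L (w n) \<phi> + regular_distr L (flux n (J n) (dJ n)) \<phi> - regular_distr L (f n) \<phi>"
    using n \<phi>L2 by (simp add: regular_distr_diff regular_distr_add L2_add flux_L2 w_L2 J_L2 f_L2)
  ultimately show ?thesis by simp
qed

definition residual :: "nat \<Rightarrow> real \<Rightarrow> real" where
  "residual n x = w n x + flux n (J n) (dJ n) x - f n x"

lemma residual_L2: "n \<in> {1..N} \<Longrightarrow> residual n \<in> L2 L"
  unfolding residual_def[abs_def] by (intro L2_add L2_diff flux_L2 w_L2 J_L2 f_L2)

text \<open>The equation of step n is tested with U^j and U^(j-1), which lie in H^1_0, and the
  results are subtracted. The index j is independent of n because J n combines all w j with j <=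
  n.\<close>

lemma tested_w:
  assumes "n \<in> {1..N}" "j \<in> {1..N}"
  shows "regular_distr L (w j) (residual n) + regular_distr L (dw j) (dJ n) = 0"
proof -
  have test: "regular_distr L (residual n) (U i) + regular_distr L (dJ n) (D (U i)) = 0" if "i \<le> N" for i
    using weak_form[OF assms(1)]
    by (intro H10_weak_equation_extends[OF L residual_L2[OF assms(1)] J_L2(2)[OF assms(1)] U_H10[OF that]])
      (simp add: residual_def[abs_def])
  have "j \<le> N" "j - 1 \<le> N" using assms by auto
  note jN = this
  have "regular_distr L (w j) (residual n)
      = 1 / k * regular_distr L (\<lambda>x. U j x - U (j - 1) x) (residual n)"
    "regular_distr L (dw j) (dJ n) = 1 / k * regular_distr L (\<lambda>x. D (U j) x - D (U (j - 1)) x) (dJ n)"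
    unfolding regular_distr_cmult[symmetric] by (simp_all add: w_def[abs_def] dw_def[abs_def])
  then show ?thesis
    using test[OF jN(1)] test[OF jN(2)]
      regular_distr_diff[OF U_L2(1)[OF jN(1)] U_L2(1)[OF jN(2)] residual_L2[OF assms(1)]]
      regular_distr_diff[OF U_L2(2)[OF jN(1)] U_L2(2)[OF jN(2)] J_L2(2)[OF assms(1)]]
    by (simp add: regular_distr_commute algebra_simps flip: add_divide_distrib diff_divide_distrib)
qed

lemma tested_J:
  assumes "n \<in> {1..N}"
  shows "regular_distr L (J n) (residual n) + regular_distr L (dJ n) (dJ n) = 0"
proof -
  have "regular_distr L (J n) (residual n) = (\<Sum>j=1..n. b (n - j) * regular_distr L (w j) (residual n))"
    unfolding J_def[abs_def] using assms by (intro regular_distr_sum w_L2 residual_L2) auto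
  moreover have "regular_distr L (dJ n) (dJ n) = (\<Sum>j=1..n. b (n - j) * regular_distr L (dw j) (dJ n))"
    by (subst (1) dJ_def[abs_def]) (use assms in \<open>auto intro!: regular_distr_sum w_L2 J_L2\<close>)
  ultimately have "regular_distr L (J n) (residual n) + regular_distr L (dJ n) (dJ n)
      = (\<Sum>j=1..n. b (n - j) * (regular_distr L (w j) (residual n) + regular_distr L (dw j) (dJ n)))"
    by (simp add: sum.distrib distrib_left)
  also have "\<dots> = 0" using tested_w assms by (intro sum.neutral) auto
  finally show ?thesis .
qed

end

section \<open>Energy estimate and stability\<close>

lemma L2_square_integrable: "u \<in> L2 L \<Longrightarrow> integrable (Omega L) (\<lambda>x. (u x)\<^sup>2)"
  by (simp add: L2_def)

context implicit_scheme
begin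

definition initial_energy :: "real \<Rightarrow> real" where
  "initial_energy x = (U 0 x)\<^sup>2 + (D (U 0) x)\<^sup>2 + (D (D (U 0)) x)\<^sup>2"

text \<open>The integrand of the equation tested with w + 2 C J. Its integral is 0, and it is
  carried through the estimates at fixed x until the integration.\<close>

definition tested :: "nat \<Rightarrow> real \<Rightarrow> real" where
  "tested n x = residual n x * (w n x + 2 * C * J n x) + dJ n x * (dw n x + 2 * C * dJ n x)"

text \<open>A majorant of the square of f n at x.\<close>

definition source :: "nat \<Rightarrow> real \<Rightarrow> real" where
  "source n x = 2 * (g n x)\<^sup>2 + 2 * (b (n - 1) / k)\<^sup>2 * C * initial_energy x"

text \<open>A majorant of the square of J n at x, from the weighted Cauchy-Schwarz
  inequality.\<close>

definition history :: "nat \<Rightarrow> real \<Rightarrow> real" where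
  "history n x = (real n * k) powr \<alpha> / Gamma (\<alpha> + 1) * (\<Sum>j=1..n. b (n - j) * (w j x)\<^sup>2)"

lemma alpha_pos: "0 < \<alpha>" using \<alpha> by simp

lemma integrable_tested: "n \<in> {1..N} \<Longrightarrow> integrable (Omega L) (tested n)"
  unfolding tested_def[abs_def]
  by (intro Bochner_Integration.integrable_add integrable_L2_mult residual_L2 L2_add L2_cmult w_L2 J_L2)

lemma integral_tested:
  assumes "n \<in> {1..N}"
  shows "(\<integral>x. tested n x \<partial>Omega L) = 0"
proof -
  have "(\<integral>x. tested n x \<partial>Omega L) = regular_distr L (residual n) (\<lambda>x. w n x + 2 * C * J n x)
      + regular_distr L (dJ n) (\<lambda>x. dw n x + 2 * C * dJ n x)"
    unfolding tested_def regular_distr_def using assms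
    by (intro Bochner_Integration.integral_add integrable_L2_mult residual_L2 L2_add L2_cmult w_L2 J_L2)
  also have "\<dots> = (regular_distr L (w n) (residual n) + regular_distr L (dw n) (dJ n))
      + 2 * C * (regular_distr L (J n) (residual n) + regular_distr L (dJ n) (dJ n))"
    using regular_distr_add[OF w_L2(1)[OF assms] L2_cmult[OF J_L2(1)[OF assms], of "2 * C"] residual_L2[OF assms]]
      regular_distr_add[OF w_L2(2)[OF assms] L2_cmult[OF J_L2(2)[OF assms], of "2 * C"] J_L2(2)[OF assms]]
    by (simp add: regular_distr_commute[of L "residual n"] regular_distr_commute[of L "dJ n" "\<lambda>x. dw n x + _ x"]
        regular_distr_cmult distrib_left)
  also have "\<dots> = 0" using tested_w[OF assms assms] tested_J[OF assms] by simp
  finally show ?thesis .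
qed

text \<open>Staying at a fixed x makes the positivity of the convex kernel applicable to real
  sequences, once to the values of w and once to those of dw, before any integration.\<close>

lemma pointwise_energy:
  assumes "m \<le> N" and x: "0 < x" "x < L" and C: "0 \<le> C"
  shows "(\<Sum>n=1..m. (w n x)\<^sup>2) \<le> 2 * (C\<^sup>2 + 2 * C) * (\<Sum>n=1..m. history n x)
    + 2 * (1 + C) * (\<Sum>n=1..m. source n x) + 2 * (\<Sum>n=1..m. tested n x)"
proof -
  have "(w n x)\<^sup>2 / 2 \<le> (C\<^sup>2 + 2 * C) * history n x + (1 + C) * source n x + tested n x
      - dJ n x * dw n x - 2 * C * (J n x * w n x)" if n: "n \<in> {1..m}" for n
  proof -
    have nN: "n \<in> {1..N}" using n assms by auto
    note F' = F(2)[OF nN x]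
    have "(w n x)\<^sup>2 / 2 \<le> (C\<^sup>2 + 2 * C) * (J n x)\<^sup>2 + (1 + C) * (f n x)\<^sup>2 + tested n x
        - dJ n x * dw n x - 2 * C * (w n x * J n x)"
      unfolding tested_def residual_def flux_def by (rule energy_pointwise[OF F'])
    moreover have "(J n x)\<^sup>2 \<le> history n x"
      unfolding J_def history_def using alpha_pos k by (rule weighted_sum_square_le)
    then have "(C\<^sup>2 + 2 * C) * (J n x)\<^sup>2 \<le> (C\<^sup>2 + 2 * C) * history n x"
      using C by (intro mult_left_mono) auto
    moreover have "(f n x)\<^sup>2 \<le> source n x"
      unfolding f_def flux_def source_def initial_energy_def by (rule source_pointwise[OF F'])
    then have "(1 + C) * (f n x)\<^sup>2 \<le> (1 + C) * source n x"
      using C by (intro mult_left_mono) auto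
    ultimately show ?thesis by (simp add: mult.commute[of "w n x"])
  qed
  then have "(\<Sum>n=1..m. (w n x)\<^sup>2 / 2) \<le> (\<Sum>n=1..m. (C\<^sup>2 + 2 * C) * history n x + (1 + C) * source n x
      + tested n x - dJ n x * dw n x - 2 * C * (J n x * w n x))"
    by (rule sum_mono)
  also have "\<dots> = (C\<^sup>2 + 2 * C) * (\<Sum>n=1..m. history n x) + (1 + C) * (\<Sum>n=1..m. source n x)
      + (\<Sum>n=1..m. tested n x) - (\<Sum>n=1..m. dJ n x * dw n x) - 2 * C * (\<Sum>n=1..m. J n x * w n x)"
    by (simp only: sum.distrib sum_subtractf sum_distrib_left)
  finally have "(\<Sum>n=1..m. (w n x)\<^sup>2) / 2 \<le> \<dots>" by (simp only: sum_divide_distrib)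
  moreover have "0 \<le> (\<Sum>n=1..m. dJ n x * dw n x)" "0 \<le> (\<Sum>n=1..m. J n x * w n x)"
    unfolding dJ_def J_def using alpha_pos \<alpha>
    by (intro convex_kernel_nonneg quad_weight_nonneg quad_weight_decreasing quad_weight_convex; simp)+
  then have "0 \<le> 2 * C * (\<Sum>n=1..m. J n x * w n x)" using C by simp
  ultimately show ?thesis
    using \<open>0 \<le> (\<Sum>n=1..m. dJ n x * dw n x)\<close> by (simp add: algebra_simps)
qed

lemma integral_initial_energy:
  "integrable (Omega L) initial_energy"
  "(\<integral>x. initial_energy x \<partial>Omega L) = (sobolev_norm L 2 (U 0))\<^sup>2"
proof -
  have sq: "integrable (Omega L) (\<lambda>x. (U 0 x)\<^sup>2)" "integrable (Omega L) (\<lambda>x. (D (U 0) x)\<^sup>2)"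
    "integrable (Omega L) (\<lambda>x. (D (D (U 0)) x)\<^sup>2)"
    using U_L2[of 0] sobolev_2(1)[OF U0(2)] by (auto intro: L2_square_integrable)
  then show "integrable (Omega L) initial_energy"
    unfolding initial_energy_def[abs_def] by simp
  show "(\<integral>x. initial_energy x \<partial>Omega L) = (sobolev_norm L 2 (U 0))\<^sup>2"
    using sq by (simp add: initial_energy_def sobolev_norm_2 L2_norm_square)
qed

lemma integral_source:
  assumes "n \<in> {1..N}"
  shows "integrable (Omega L) (source n)"
    "(\<integral>x. source n x \<partial>Omega L)
      = 2 * (L2_norm L (g n))\<^sup>2 + 2 * (b (n - 1) / k)\<^sup>2 * C * (sobolev_norm L 2 (U 0))\<^sup>2"
proof -
  note int = L2_square_integrable[OF g[OF assms]] integral_initial_energy(1)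
  show "integrable (Omega L) (source n)"
    unfolding source_def[abs_def] using int by simp
  show "(\<integral>x. source n x \<partial>Omega L)
      = 2 * (L2_norm L (g n))\<^sup>2 + 2 * (b (n - 1) / k)\<^sup>2 * C * (sobolev_norm L 2 (U 0))\<^sup>2"
    unfolding source_def using int
    by (simp add: L2_norm_square integral_initial_energy(2))
qed

lemma integral_history:
  assumes "n \<in> {1..N}"
  shows "integrable (Omega L) (history n)"
    "(\<integral>x. history n x \<partial>Omega L)
      = (real n * k) powr \<alpha> / Gamma (\<alpha> + 1) * (\<Sum>j=1..n. b (n - j) * (L2_norm L (w j))\<^sup>2)"
proof -
  have int: "integrable (Omega L) (\<lambda>x. b (n - j) * (w j x)\<^sup>2)" if "j \<in> {1..n}" for j
    using that assms w_L2(1)[of j] by (simp add: L2_square_integrable)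
  then have "integrable (Omega L) (\<lambda>x. \<Sum>j=1..n. b (n - j) * (w j x)\<^sup>2)"
    by (rule Bochner_Integration.integrable_sum)
  then show "integrable (Omega L) (history n)"
    unfolding history_def[abs_def] by (rule integrable_mult_right)
  have "(\<integral>x. (\<Sum>j=1..n. b (n - j) * (w j x)\<^sup>2) \<partial>Omega L) = (\<Sum>j=1..n. b (n - j) * (L2_norm L (w j))\<^sup>2)"
    using int by (subst Bochner_Integration.integral_sum) (auto simp: L2_norm_square)
  then show "(\<integral>x. history n x \<partial>Omega L)
      = (real n * k) powr \<alpha> / Gamma (\<alpha> + 1) * (\<Sum>j=1..n. b (n - j) * (L2_norm L (w j))\<^sup>2)"
    unfolding history_def by simp
qed

lemma C_ge_1:
  assumes "1 \<le> N"
  shows "1 \<le> C"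
proof -
  have "1 + (F (L / 2) (real 1 * k))\<^sup>2 + (deriv (\<lambda>y. F y (real 1 * k)) (L / 2))\<^sup>2 \<le> C"
    using assms L by (intro F(2)) auto
  then show ?thesis
    using zero_le_power2[of "F (L / 2) (real 1 * k)"]
      zero_le_power2[of "deriv (\<lambda>y. F y (real 1 * k)) (L / 2)"] by linarith
qed

lemma integrated_energy:
  assumes m: "m \<in> {1..N}"
  shows "(\<Sum>j=1..m. (L2_norm L (w j))\<^sup>2)
    \<le> (\<Sum>j=1..m. 4 * (1 + C) * ((L2_norm L (g j))\<^sup>2 + (b (j - 1) / k)\<^sup>2 * C * (sobolev_norm L 2 (U 0))\<^sup>2))
    + 2 * (C\<^sup>2 + 2 * C) * (\<Sum>n=1..m. (real n * k) powr \<alpha> / Gamma (\<alpha> + 1) *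
        (\<Sum>j=1..n. b (n - j) * (L2_norm L (w j))\<^sup>2))"
proof -
  have n: "n \<in> {1..N}" if "n \<in> {1..m}" for n using that m by auto
  have C: "0 \<le> C" using C_ge_1 m by simp
  have iw: "integrable (Omega L) (\<lambda>x. (w n x)\<^sup>2)" if "n \<in> {1..m}" for n
    using w_L2(1)[OF n[OF that]] by (rule L2_square_integrable)
  note ih = integral_history[OF n] and so = integral_source[OF n]
    and it = integrable_tested[OF n] integral_tested[OF n]
  have "(\<Sum>j=1..m. (L2_norm L (w j))\<^sup>2) = (\<integral>x. (\<Sum>n=1..m. (w n x)\<^sup>2) \<partial>Omega L)"
    using iw by (subst Bochner_Integration.integral_sum) (auto simp: L2_norm_square)
  also have "\<dots> \<le> (\<integral>x. 2 * (C\<^sup>2 + 2 * C) * (\<Sum>n=1..m. history n x)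
    + 2 * (1 + C) * (\<Sum>n=1..m. source n x) + 2 * (\<Sum>n=1..m. tested n x) \<partial>Omega L)"
  proof (rule integral_mono)
    show "integrable (Omega L) (\<lambda>x. \<Sum>n=1..m. (w n x)\<^sup>2)"
      using iw by (rule Bochner_Integration.integrable_sum)
    show "integrable (Omega L) (\<lambda>x. 2 * (C\<^sup>2 + 2 * C) * (\<Sum>n=1..m. history n x)
        + 2 * (1 + C) * (\<Sum>n=1..m. source n x) + 2 * (\<Sum>n=1..m. tested n x))"
      by (intro Bochner_Integration.integrable_add integrable_mult_right
          Bochner_Integration.integrable_sum ih(1) so(1) it(1))
  qed (rule pointwise_energy, use m C in auto)
  also have "\<dots> = 2 * (C\<^sup>2 + 2 * C) * (\<Sum>n=1..m. \<integral>x. history n x \<partial>Omega L)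
    + 2 * (1 + C) * (\<Sum>n=1..m. \<integral>x. source n x \<partial>Omega L) + 2 * (\<Sum>n=1..m. \<integral>x. tested n x \<partial>Omega L)"
    using ih(1) so(1) it(1)
    by (simp only: Bochner_Integration.integral_add Bochner_Integration.integral_sum integral_mult_right_zero
        Bochner_Integration.integrable_add Bochner_Integration.integrable_sum integrable_mult_right)
  also have "(\<Sum>n=1..m. \<integral>x. tested n x \<partial>Omega L) = 0" using it(2) by simp
  also have "(\<Sum>n=1..m. \<integral>x. source n x \<partial>Omega L)
      = (\<Sum>n=1..m. 2 * (L2_norm L (g n))\<^sup>2 + 2 * (b (n - 1) / k)\<^sup>2 * C * (sobolev_norm L 2 (U 0))\<^sup>2)"
    using so(2) by (rule sum.cong[OF refl])
  also have "(\<Sum>n=1..m. \<integral>x. history n x \<partial>Omega L)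
      = (\<Sum>n=1..m. (real n * k) powr \<alpha> / Gamma (\<alpha> + 1) * (\<Sum>j=1..n. b (n - j) * (L2_norm L (w j))\<^sup>2))"
    using ih(2) by (rule sum.cong[OF refl])
  finally show ?thesis by (simp add: sum_distrib_left algebra_simps)
qed

text \<open>Telescoping and Cauchy-Schwarz over n terms. The factor k^2 n is t_n k: t_n stands in
  front of the final bound, and k turns the sum of squares into a time integral.\<close>

lemma increment_square:
  assumes n: "n \<in> {1..N}"
  shows "(L2_norm L (\<lambda>x. U n x - U 0 x))\<^sup>2 \<le> k\<^sup>2 * real n * (\<Sum>j=1..n. (L2_norm L (w j))\<^sup>2)"
proof -
  have jN: "j \<in> {1..N}" if "j \<in> {1..n}" for j using that n by auto
  have iw: "integrable (Omega L) (\<lambda>x. (w j x)\<^sup>2)" if "j \<in> {1..n}" for j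
    using w_L2(1)[OF jN[OF that]] by (rule L2_square_integrable)
  have tel: "U n x - U 0 x = k * (\<Sum>j=1..n. w j x)" for x
  proof -
    have "(\<Sum>j=1..n. U j x - U (j - 1) x) = U n x - U 0 x"
      using sum_telescope''[of 0 n "\<lambda>j. U j x"] by simp
    then show ?thesis using k by (simp add: w_def flip: sum_divide_distrib)
  qed
  have "(U n x - U 0 x)\<^sup>2 \<le> k\<^sup>2 * real n * (\<Sum>j=1..n. (w j x)\<^sup>2)" for x
  proof -
    have "(\<Sum>j=1..n. 1 * w j x)\<^sup>2 \<le> (\<Sum>j=1..n. 1\<^sup>2) * (\<Sum>j=1..n. (w j x)\<^sup>2)"
      by (rule Cauchy_Schwarz_ineq_sum)
    then have "k\<^sup>2 * (\<Sum>j=1..n. w j x)\<^sup>2 \<le> k\<^sup>2 * (real n * (\<Sum>j=1..n. (w j x)\<^sup>2))"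
      by (intro mult_left_mono) auto
    then show ?thesis by (simp add: tel power_mult_distrib mult.assoc)
  qed
  moreover have "integrable (Omega L) (\<lambda>x. (U n x - U 0 x)\<^sup>2)"
    using n by (intro L2_square_integrable L2_diff U_L2) auto
  ultimately have "(\<integral>x. (U n x - U 0 x)\<^sup>2 \<partial>Omega L)
      \<le> (\<integral>x. k\<^sup>2 * real n * (\<Sum>j=1..n. (w j x)\<^sup>2) \<partial>Omega L)"
    by (intro integral_mono integrable_mult_right Bochner_Integration.integrable_sum iw)
  also have "\<dots> = k\<^sup>2 * real n * (\<Sum>j=1..n. \<integral>x. (w j x)\<^sup>2 \<partial>Omega L)"
    using iw by (simp add: Bochner_Integration.integral_sum)
  finally show ?thesis by (simp add: L2_norm_square)
qed

lemma stability:
  assumes n: "n \<in> {1..N}"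
    and small: "2 * (C\<^sup>2 + 2 * C) * ((real N * k) powr \<alpha> / Gamma (\<alpha> + 1)) * (k powr \<alpha> / Gamma (\<alpha> + 1)) \<le> 1/2"
  shows "(L2_norm L (\<lambda>x. U n x - U 0 x))\<^sup>2 \<le> real n * k *
    mittag_leffler \<alpha> (24 * C * (1 + 2 * C) * (real n * k) powr (2 * \<alpha>) / Gamma (\<alpha> + 1)) *
    (6 * (1 + 2 * C) * (\<Sum>j=1..n. k * (L2_norm L (g j))\<^sup>2)
      + 6 * C * (1 + 4 * C) * (sobolev_norm L 2 (U 0))\<^sup>2
        * (1 + (real n * k) powr (2 * \<alpha> - 1) / (2 * \<alpha> - 1)))"
proof -
  define Y where "Y j = (L2_norm L (w j))\<^sup>2" for j
  define S where "S = (sobolev_norm L 2 (U 0))\<^sup>2"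
  define G where "G = (\<Sum>j=1..n. k * (L2_norm L (g j))\<^sup>2)"
  define \<tau> where "\<tau> = (real n * k) powr (2 * \<alpha> - 1) / (2 * \<alpha> - 1)"
  define a where "a j = 4 * (1 + C) * ((L2_norm L (g j))\<^sup>2 + (b (j - 1) / k)\<^sup>2 * C * S)" for j
  define M where "M = 2 * (C\<^sup>2 + 2 * C)"
  define E where "E = mittag_leffler \<alpha> (24 * C * (1 + 2 * C) * (real n * k) powr (2 * \<alpha>) / Gamma (\<alpha> + 1))"
  have C: "1 \<le> C" using C_ge_1 n by simp
  have \<Gamma>: "0 < Gamma (\<alpha> + 1)" using \<alpha> by (intro Gamma_real_pos) auto
  have M: "0 \<le> M" using C by (simp add: M_def)
  have S: "0 \<le> S" and G: "0 \<le> G" and \<tau>: "0 \<le> \<tau>"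
    using k \<alpha> by (auto simp: S_def G_def \<tau>_def intro!: sum_nonneg)
  \<comment> \<open>The smallness condition refers to the final time, so that one threshold for k
    serves every n.\<close>
  have "(real n * k) powr \<alpha> / Gamma (\<alpha> + 1) \<le> (real N * k) powr \<alpha> / Gamma (\<alpha> + 1)"
    using n k \<alpha> \<Gamma> by (intro divide_right_mono powr_mono2) auto
  then have "M * ((real n * k) powr \<alpha> / Gamma (\<alpha> + 1)) * b 0
      \<le> M * ((real N * k) powr \<alpha> / Gamma (\<alpha> + 1)) * b 0"
    using M quad_weight_nonneg[OF alpha_pos] by (intro mult_right_mono mult_left_mono) auto
  also have "b 0 = k powr \<alpha> / Gamma (\<alpha> + 1)" by (simp add: quad_weight_def)
  also have "M * ((real N * k) powr \<alpha> / Gamma (\<alpha> + 1)) * (k powr \<alpha> / Gamma (\<alpha> + 1)) \<le> 1/2"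
    using small by (simp add: M_def)
  finally have small': "M * ((real n * k) powr \<alpha> / Gamma (\<alpha> + 1)) * b 0 \<le> 1/2"
    by (simp add: quad_weight_def)
  have "(\<Sum>j=1..n. Y j) \<le> 2 * (\<Sum>j=1..n. a j)
      * mittag_leffler \<alpha> (2 * M * (real n * k) powr (2 * \<alpha>) / Gamma (\<alpha> + 1))"
  proof (rule absorbed_fractional_gronwall[OF \<alpha> k M _ _ small'])
    show "0 \<le> a j" for j using C S by (simp add: a_def)
    show "(\<Sum>j=1..m. Y j) \<le> (\<Sum>j=1..m. a j)
      + M * (\<Sum>i=1..m. (real i * k) powr \<alpha> / Gamma (\<alpha> + 1) * (\<Sum>j=1..i. b (i - j) * Y j))"
      if "m \<in> {1..n}" for m
      unfolding Y_def a_def M_def S_def using that n by (intro integrated_energy) auto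
  qed (use n in \<open>auto simp: Y_def\<close>)
  also have "\<dots> \<le> 2 * (\<Sum>j=1..n. a j) * E"
  proof -
    \<comment> \<open>Here 2 M = 4 C^2 + 8 C, which lies below the constant C1, and the
      Mittag-Leffler function is increasing.\<close>
    have "2 * M \<le> 24 * C * (1 + 2 * C)"
      using C by (simp add: M_def power2_eq_square algebra_simps)
    then have "mittag_leffler \<alpha> (2 * M * (real n * k) powr (2 * \<alpha>) / Gamma (\<alpha> + 1)) \<le> E"
      unfolding E_def using \<alpha> M \<Gamma>
      by (intro mittag_leffler_mono divide_right_mono mult_right_mono) auto
    then show ?thesis using C S by (intro mult_left_mono) (auto simp: a_def intro!: sum_nonneg)
  qed
  finally have y: "k * (\<Sum>j=1..n. Y j) \<le> (2 * k * (\<Sum>j=1..n. a j)) * E"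
    using mult_left_mono[OF _ less_imp_le[OF k]] by fastforce
  have "k * (\<Sum>j=1..n. (b (j - 1) / k)\<^sup>2) = (\<Sum>m<n. (b m)\<^sup>2) / k"
  proof -
    have "(\<Sum>j=1..n. (b (j - 1) / k)\<^sup>2) = (\<Sum>m<n. (b m / k)\<^sup>2)"
      by (rule sum.reindex_bij_witness[of _ Suc "\<lambda>j. j - 1"]) auto
    also have "\<dots> = (\<Sum>m<n. (b m)\<^sup>2) / k\<^sup>2" by (simp add: power_divide sum_divide_distrib)
    finally show ?thesis using k by (simp add: power2_eq_square)
  qed
  also have "\<dots> \<le> \<tau>"
    using quad_weight_square_sum[OF \<alpha> k, of n] k by (simp add: \<tau>_def pos_divide_le_eq mult_ac)
  finally have \<tau>': "k * (\<Sum>j=1..n. (b (j - 1) / k)\<^sup>2) \<le> \<tau>" .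
  have "2 * k * (\<Sum>j=1..n. a j) = 8 * (1 + C) * (G + k * (\<Sum>j=1..n. (b (j - 1) / k)\<^sup>2) * (C * S))"
    by (simp add: a_def G_def sum_distrib_left sum_distrib_right sum.distrib algebra_simps)
  also have "\<dots> \<le> 8 * (1 + C) * (G + \<tau> * (C * S))"
    using \<tau>' C S by (intro mult_left_mono add_left_mono mult_right_mono) auto
  also have "\<dots> = 8 * (1 + C) * G + (8 * (1 + C) * C) * (S * \<tau>)" by (simp add: algebra_simps)
  \<comment> \<open>The 8 is a factor 2 from the absorption times the 4 in \<open>a\<close>. By C >=
    1, 8 (1 + C) <= 6 (1 + 2 C) and 8 (1 + C) C <= 6 C (1 + 4 C), so the constants obtained lie
    below C2 and C3.\<close>
  also have "\<dots> \<le> 6 * (1 + 2 * C) * G + (6 * C * (1 + 4 * C)) * (S * (1 + \<tau>))"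
  proof -
    have "8 * (1 + C) * C \<le> 6 * (1 + 4 * C) * C" using C by (intro mult_right_mono) auto
    also have "\<dots> = 6 * C * (1 + 4 * C)" by (simp add: algebra_simps)
    finally have "8 * (1 + C) * C * (S * \<tau>) \<le> 6 * C * (1 + 4 * C) * (S * (1 + \<tau>))"
      using C S \<tau> by (rule_tac mult_mono) (auto intro!: mult_left_mono)
    moreover have "8 * (1 + C) * G \<le> 6 * (1 + 2 * C) * G"
      using C G by (intro mult_right_mono) auto
    ultimately show ?thesis by linarith
  qed
  finally have A: "2 * k * (\<Sum>j=1..n. a j) \<le> 6 * (1 + 2 * C) * G + 6 * C * (1 + 4 * C) * S * (1 + \<tau>)"
    by (simp only: mult.assoc)
  have "0 \<le> E"
    unfolding E_def using C \<alpha> \<Gamma> by (intro mittag_leffler_nonneg) auto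
  have "(L2_norm L (\<lambda>x. U n x - U 0 x))\<^sup>2 \<le> real n * k * (k * (\<Sum>j=1..n. Y j))"
    using increment_square[OF n] by (simp add: Y_def power2_eq_square mult_ac)
  also have "\<dots> \<le> real n * k * ((6 * (1 + 2 * C) * G + 6 * C * (1 + 4 * C) * S * (1 + \<tau>)) * E)"
    using k order.trans[OF y mult_right_mono[OF A \<open>0 \<le> E\<close>]] by (intro mult_left_mono) auto
  finally show ?thesis
    unfolding E_def G_def S_def \<tau>_def by (simp only: mult_ac)
qed

end

section \<open>The threshold for the time step\<close>

theorem theorem4p3:
  fixes L T \<alpha> C_F :: real
  assumes "0 < L" and "0 < T" and "1 / 2 < \<alpha>" and "\<alpha> \<le> 1"
  shows "\<exists>k0>0. \<forall>(N::nat) (k::real) (F::real \<Rightarrow> real \<Rightarrow> real)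
           (g::nat \<Rightarrow> real \<Rightarrow> real) (U::nat \<Rightarrow> real \<Rightarrow> real).
      1 \<le> N \<and> k = T / real N \<and> k \<le> k0 \<and>
      U 0 \<in> H10 L \<inter> sobolev L 2 \<and>
      (\<forall>n\<in>{1..N}. g n \<in> L2 L) \<and>
      (\<forall>n\<in>{1..N}. \<forall>x\<in>{0<..<L}. (\<lambda>y. F y (real n * k)) differentiable (at x) \<and>
         1 + (F x (real n * k))\<^sup>2 + (deriv (\<lambda>y. F y (real n * k)) x)\<^sup>2 \<le> C_F) \<and>
      (\<forall>n\<in>{1..N}. U n \<in> H10 L \<and> scheme_step L \<alpha> k F g U n)
      \<longrightarrow> (\<forall>n\<in>{1..N}.
        let t = real n * k;
            C1 = 24 * C_F * (1 + 2 * C_F);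
            C2 = 6 * (1 + 2 * C_F);
            C3 = 6 * C_F * (1 + 4 * C_F)
        in (L2_norm L (\<lambda>x. U n x - U 0 x))\<^sup>2
           \<le> t * mittag_leffler \<alpha> (C1 * t powr (2 * \<alpha>) / Gamma (\<alpha> + 1)) *
             (C2 * (\<Sum>j=1..n. k * (L2_norm L (g j))\<^sup>2)
              + C3 * (sobolev_norm L 2 (U 0))\<^sup>2
                  * (1 + t powr (2 * \<alpha> - 1) / (2 * \<alpha> - 1))))"
proof -
  \<comment> \<open>The threshold is fixed before F and U are given, when C_F may still be any real
    number; the absolute value and the + 1 keep M positive.\<close>
  define M where "M = \<bar>2 * (C_F\<^sup>2 + 2 * C_F)\<bar> + 1"
  define K where "K = M * (T powr \<alpha> / Gamma (\<alpha> + 1)) / Gamma (\<alpha> + 1)"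
  \<comment> \<open>The solution of K k0^\<alpha> = 1/2, which implies the absorption condition for
    every k <= k0.\<close>
  define k0 where "k0 = (1 / (2 * K)) powr (1 / \<alpha>)"
  have "0 < M" by (simp add: M_def)
  moreover have \<Gamma>: "0 < Gamma (\<alpha> + 1)" using assms by (intro Gamma_real_pos) auto
  ultimately have K: "0 < K" using assms by (simp add: K_def)
  then have "0 < k0" by (simp add: k0_def)
  moreover have small: "2 * (C_F\<^sup>2 + 2 * C_F) * (T powr \<alpha> / Gamma (\<alpha> + 1)) * (k powr \<alpha> / Gamma (\<alpha> + 1)) \<le> 1/2"
    if "0 < k" "k \<le> k0" for k
  proof -
    have "2 * (C_F\<^sup>2 + 2 * C_F) * ((T powr \<alpha> / Gamma (\<alpha> + 1)) * (k powr \<alpha> / Gamma (\<alpha> + 1)))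
        \<le> M * ((T powr \<alpha> / Gamma (\<alpha> + 1)) * (k powr \<alpha> / Gamma (\<alpha> + 1)))"
      using \<Gamma> unfolding M_def by (intro mult_right_mono) auto
    also have "\<dots> = K * k powr \<alpha>" by (simp add: K_def)
    also have "\<dots> \<le> K * k0 powr \<alpha>"
      using that K assms by (intro mult_left_mono powr_mono2) auto
    also have "\<dots> = 1/2"
      using K assms by (simp add: k0_def powr_powr)
    finally show ?thesis by (simp add: mult.assoc)
  qed
  moreover have "(L2_norm L (\<lambda>x. U n x - U 0 x))\<^sup>2 \<le> real n * k *
      mittag_leffler \<alpha> (24 * C_F * (1 + 2 * C_F) * (real n * k) powr (2 * \<alpha>) / Gamma (\<alpha> + 1)) *
      (6 * (1 + 2 * C_F) * (\<Sum>j=1..n. k * (L2_norm L (g j))\<^sup>2)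
        + 6 * C_F * (1 + 4 * C_F) * (sobolev_norm L 2 (U 0))\<^sup>2
          * (1 + (real n * k) powr (2 * \<alpha> - 1) / (2 * \<alpha> - 1)))"
    if "1 \<le> N" "k = T / real N" "k \<le> k0" "U 0 \<in> H10 L \<inter> sobolev L 2" "\<forall>n\<in>{1..N}. g n \<in> L2 L"
      "\<forall>n\<in>{1..N}. \<forall>x\<in>{0<..<L}. (\<lambda>y. F y (real n * k)) differentiable (at x) \<and>
         1 + (F x (real n * k))\<^sup>2 + (deriv (\<lambda>y. F y (real n * k)) x)\<^sup>2 \<le> C_F"
      "\<forall>n\<in>{1..N}. U n \<in> H10 L \<and> scheme_step L \<alpha> k F g U n" "n \<in> {1..N}"
    for N n k F g U
  proof -
    have "0 < k" "real N * k = T" using that(1,2) assms by auto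
    interpret implicit_scheme L k \<alpha> C_F N F g U
      by unfold_locales (use that(4-7) \<open>0 < k\<close> assms in auto)
    show ?thesis
      using that(8) small[OF \<open>0 < k\<close> that(3)] by (intro stability) (simp_all add: \<open>real N * k = T\<close>)
  qed
  ultimately show ?thesis
    unfolding Let_def by (intro exI[of _ k0] conjI allI impI ballI) blast+
qed

end
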